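(* Let $A$ be a convenient algebra. Then $(L(A),[\ ,\ ]^\wedge)$, the space of all skew symmetric polyderivations of $A$, is a graded Lie subalgebra of the Nijenhuis-Richardson algebra $(\Lambda^{*+1}(A;A),[\ ,\ ]^\wedge)$. So $(L(A),[\ ,\ ]^\wedge)$ is a convenient graded Lie algebra (called the Schouten-Nijenhuis algebra of $A$).
   Context: The ground field is $\mathbb R$. A convenient vector space is a Hausdorff locally convex space in which every Mackey-Cauchy sequence converges, equipped with its bornological topology; a map is bounded if it maps bounded sets to bounded sets. A convenient algebra is a convenient vector space $A$ with a bounded bilinear associative multiplication and a unit $1$ (not necessarily commutative). For a convenient vector space $V$, $\Lambda^k(V;V)$ is the convenient vector space of all bounded $k$-linear skew symmetric mappings $V\times\cdots\times V\to V$ ($\Lambda^0(V;V)=V$); a set of such mappings is bounded if it is uniformly bounded on products of bounded sets. For $K\in\Lambda^{k+1}(V;V)$ and $\Phi\in\Lambda^p(V;V)$ put $$(i_K\Phi)(v_1,\dots,v_{k+p})=\frac1{(k+1)!(p-1)!}\sum_\sigma\operatorname{sign}(\sigma)\,\Phi\big(K(v_{\sigma1},\dots,v_{\sigma(k+1)}),v_{\sigma(k+2)},\dots,v_{\sigma(k+p)}\big),$$ the sum over all permutations of $k+p$ symbols ($i_K\Phi=0$ if $p=0$). For $K\in\Lambda^{k+1}(V;V)$, $L\in\Lambda^{\ell+1}(V;V)$ the Nijenhuis-Richardson bracket is $[K,L]^\wedge=i_KL-(-1)^{k\ell}i_LK\in\Lambda^{k+\ell+1}(V;V)$; with it $\Lambda^{*+1}(V;V)$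 (elements of $\Lambda^{k+1}(V;V)$ having degree $k$) is a graded Lie algebra: $[K,L]^\wedge=-(-1)^{k\ell}[L,K]^\wedge$ and the graded Jacobi identity holds. $L^k(A)\subset\Lambda^{k+1}(A;A)$ is the (closed) subspace of all $K$ such that for all $a_1,\dots,a_k\in A$ the linear map $a\mapsto K(a,a_1,\dots,a_k)$ is a derivation of $A$, and $L(A)=\bigoplus_{k\ge0}L^k(A)$. A convenient graded Lie algebra is a graded Lie algebra whose homogeneous components are convenient vector spaces and whose bracket is bounded. *)

theory Defs
  imports "HOL-Analysis.Analysis" "HOL-Library.Function_Algebras"
begin

instantiation "fun" :: (type, real_vector) real_vector
begin

definition scaleR_fun :: "real \<Rightarrow> ('a \<Rightarrow> 'b) \<Rightarrow> 'a \<Rightarrow> 'b"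
  where "scaleR_fun c f = (\<lambda>x. c *\<^sub>R f x)"

instance
  by standard (simp_all add: scaleR_fun_def fun_eq_iff algebra_simps)

end

section \<open>Convenient vector spaces\<close>

text \<open>
  The underlying vector space of a topology \<open>T\<close> is \<open>topspace T\<close>, a linear subspace of a real
  vector space type. The topology is a value and not a type class instance, because the spaces of
  multilinear maps below carry topologies that depend on parameters.
\<close>

definition locally_convex_space :: "'v::real_vector topology \<Rightarrow> bool" where
  "locally_convex_space T \<longleftrightarrow>
     subspace (topspace T) \<and>
     continuous_map (prod_topology T T) T (\<lambda>(x, y). x + y) \<and>
     continuous_map (prod_topology euclideanreal T) T (\<lambda>(c, x). c *\<^sub>R x) \<and>
     (\<forall>U. openin T U \<and> 0 \<in> U \<longrightarrow> (\<exists>W. openin T W \<and> 0 \<in> W \<and> W \<subseteq> U \<and> convex W))"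

definition absorbs :: "'v::real_vector set \<Rightarrow> 'v set \<Rightarrow> bool" where
  "absorbs U B \<longleftrightarrow> (\<exists>r>0. \<forall>c. r \<le> \<bar>c\<bar> \<longrightarrow> B \<subseteq> (*\<^sub>R) c ` U)"

definition vn_bounded :: "'v::real_vector topology \<Rightarrow> 'v set \<Rightarrow> bool" where
  "vn_bounded T B \<longleftrightarrow> B \<subseteq> topspace T \<and> (\<forall>U. openin T U \<and> 0 \<in> U \<longrightarrow> absorbs U B)"

definition absolutely_convex :: "'v::real_vector set \<Rightarrow> bool" where
  "absolutely_convex U \<longleftrightarrow> convex U \<and> (\<forall>x\<in>U. \<forall>c. \<bar>c\<bar> \<le> 1 \<longrightarrow> c *\<^sub>R x \<in> U)"

definition mackey_cauchy :: "'v::real_vector topology \<Rightarrow> (nat \<Rightarrow> 'v) \<Rightarrow> bool" where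
  "mackey_cauchy T x \<longleftrightarrow>
     range x \<subseteq> topspace T \<and>
     (\<exists>B \<mu>. vn_bounded T B \<and> absolutely_convex B \<and>
        (\<mu> \<longlongrightarrow> (0::real)) (sequentially \<times>\<^sub>F sequentially) \<and>
        (\<forall>m n. x m - x n \<in> (*\<^sub>R) (\<mu> (m, n)) ` B))"

definition mackey_complete :: "'v::real_vector topology \<Rightarrow> bool" where
  "mackey_complete T \<longleftrightarrow> (\<forall>x. mackey_cauchy T x \<longrightarrow> (\<exists>l. limitin T x l sequentially))"

text \<open>
  The finest locally convex topology on \<open>V\<close> for which the members of \<open>\<B>\<close> are bounded: the
  absolutely convex sets absorbing all members of \<open>\<B>\<close> form a base of neighbourhoods of \<open>0\<close>.
\<close>

definition bornological_topology :: "'v::real_vector set \<Rightarrow> 'v set set \<Rightarrow> 'v topology" where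
  "bornological_topology V \<B> =
     topology (\<lambda>U. U \<subseteq> V \<and>
       (\<forall>x\<in>U. \<exists>W\<subseteq>V. absolutely_convex W \<and> (\<forall>B\<in>\<B>. absorbs W B) \<and> (+) x ` W \<subseteq> U))"

lemma openin_bornological_topology:
  "openin (bornological_topology V \<B>) U \<longleftrightarrow> U \<subseteq> V \<and>
     (\<forall>x\<in>U. \<exists>W\<subseteq>V. absolutely_convex W \<and> (\<forall>B\<in>\<B>. absorbs W B) \<and> (+) x ` W \<subseteq> U)"
proof -
  have absorbs_Int: "absorbs (W \<inter> W') B" if W: "absorbs W B" "absorbs W' B"
    for W W' B :: "'a set"
  proof -
    obtain r r' where r: "r > 0" "\<And>c. r \<le> \<bar>c\<bar> \<Longrightarrow> B \<subseteq> (*\<^sub>R) c ` W"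
      and r': "r' > 0" "\<And>c. r' \<le> \<bar>c\<bar> \<Longrightarrow> B \<subseteq> (*\<^sub>R) c ` W'"
      using W by (auto simp: absorbs_def)
    have "B \<subseteq> (*\<^sub>R) c ` (W \<inter> W')" if c: "max r r' \<le> \<bar>c\<bar>" for c
    proof -
      have "c \<noteq> 0"
        using c r(1) by auto
      then have "(*\<^sub>R) c ` (W \<inter> W') = (*\<^sub>R) c ` W \<inter> (*\<^sub>R) c ` W'"
        by (intro image_Int) (auto simp: inj_on_def)
      with r(2)[of c] r'(2)[of c] c show ?thesis
        by auto
    qed
    then show ?thesis
      using r(1) unfolding absorbs_def by (intro exI[of _ "max r r'"]) auto
  qed
  let ?N = "\<lambda>x U. \<exists>W\<subseteq>V. absolutely_convex W \<and> (\<forall>B\<in>\<B>. absorbs W B) \<and> (+) x ` W \<subseteq> U"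
  have N_mono: "?N x U'" if le: "?N x U" "U \<subseteq> U'" for x U U'
  proof -
    obtain W where "W \<subseteq> V" "absolutely_convex W" "\<forall>B\<in>\<B>. absorbs W B" "(+) x ` W \<subseteq> U"
      using le(1) by (elim exE conjE) (rule that)
    with le(2) show ?thesis
      by (intro exI[of _ W] conjI) (assumption | rule order_trans)+
  qed
  have N_Int: "?N x (U \<inter> U')" if N: "?N x U" "?N x U'" for x U U'
  proof -
    obtain W where W: "W \<subseteq> V" "absolutely_convex W" "\<forall>B\<in>\<B>. absorbs W B" "(+) x ` W \<subseteq> U"
      using N(1) by (elim exE conjE) (rule that)
    obtain W' where W': "W' \<subseteq> V" "absolutely_convex W'" "\<forall>B\<in>\<B>. absorbs W' B" "(+) x ` W' \<subseteq> U'"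
      using N(2) by (elim exE conjE) (rule that)
    have "absolutely_convex (W \<inter> W')"
      using W(2) W'(2) by (auto simp: absolutely_convex_def convex_Int)
    moreover have "\<forall>B\<in>\<B>. absorbs (W \<inter> W') B"
      using W(3) W'(3) absorbs_Int by blast
    moreover have "W \<inter> W' \<subseteq> V" "(+) x ` (W \<inter> W') \<subseteq> U \<inter> U'"
      using W(1,4) W'(4) by blast+
    ultimately show ?thesis
      by (intro exI[of _ "W \<inter> W'"] conjI)
  qed
  have "istopology (\<lambda>U. U \<subseteq> V \<and> (\<forall>x\<in>U. ?N x U))"
    unfolding istopology_def
  proof (intro conjI allI impI ballI)
    fix U U' x
    assume "U \<subseteq> V \<and> (\<forall>x\<in>U. ?N x U)" "U' \<subseteq> V \<and> (\<forall>x\<in>U'. ?N x U')" "x \<in> U \<inter> U'"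
    then show "?N x (U \<inter> U')"
      by (elim conjE IntE) (rule N_Int; erule (1) bspec)
  next
    fix \<K> x
    assume K: "\<forall>U\<in>\<K>. U \<subseteq> V \<and> (\<forall>x\<in>U. ?N x U)" and "x \<in> \<Union>\<K>"
    then obtain U where U: "U \<in> \<K>" "x \<in> U"
      by blast
    have "?N x U"
      using bspec[OF conjunct2[OF bspec[OF K U(1)]] U(2)] .
    then show "?N x (\<Union>\<K>)"
      by (rule N_mono) (rule Union_upper[OF U(1)])
  qed blast+
  then show ?thesis
    by (simp add: bornological_topology_def)
qed

text \<open>
  The bornologification of \<open>T\<close>: the finest locally convex topology with the same bounded sets.
\<close>

definition bornologification :: "'v::real_vector topology \<Rightarrow> 'v topology" where
  "bornologification T = bornological_topology (topspace T) {B. vn_bounded T B}"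

definition convenient_space :: "'v::real_vector topology \<Rightarrow> bool" where
  "convenient_space T \<longleftrightarrow>
     locally_convex_space T \<and> Hausdorff_space T \<and> mackey_complete T \<and> bornologification T = T"

definition bounded_binary :: "'u::real_vector topology \<Rightarrow> 'v::real_vector topology \<Rightarrow>
    'w::real_vector topology \<Rightarrow> ('u \<Rightarrow> 'v \<Rightarrow> 'w) \<Rightarrow> bool" where
  "bounded_binary T T' T'' f \<longleftrightarrow>
     (\<forall>B B'. vn_bounded T B \<and> vn_bounded T' B' \<longrightarrow> vn_bounded T'' {f x y | x y. x \<in> B \<and> y \<in> B'})"

text \<open>
  The operations are parameters instead of a type class, so that the zero algebra is not excluded.
\<close>

locale convenient_algebra =
  fixes T :: "'a::real_vector topology"
    and mul :: "'a \<Rightarrow> 'a \<Rightarrow> 'a"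
    and one :: 'a
  assumes topspace: "topspace T = UNIV"
    and convenient: "convenient_space T"
    and bilinear_mul: "bilinear mul"
    and bounded_mul: "bounded_binary T T T mul"
    and mul_assoc: "mul (mul a b) c = mul a (mul b c)"
    and one_mul: "mul one a = a"
    and mul_one: "mul a one = a"

section \<open>Skew symmetric multilinear maps\<close>

text \<open>
  A map in \<open>n\<close> arguments is a function on lists, set to \<open>0\<close> on lists of length different from \<open>n\<close>;
  with this convention the maps in \<open>n\<close> arguments form a linear subspace of the function space.
\<close>

definition multilinear :: "nat \<Rightarrow> ('a::real_vector list \<Rightarrow> 'a) \<Rightarrow> bool" where
  "multilinear n f \<longleftrightarrow>
     (\<forall>xs. length xs \<noteq> n \<longrightarrow> f xs = 0) \<and>
     (\<forall>xs i. length xs = n \<and> i < n \<longrightarrow> linear (\<lambda>x. f (xs[i := x])))"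

definition skew_symmetric :: "nat \<Rightarrow> ('a::real_vector list \<Rightarrow> 'a) \<Rightarrow> bool" where
  "skew_symmetric n f \<longleftrightarrow>
     (\<forall>xs \<sigma>. length xs = n \<and> \<sigma> permutes {..<n} \<longrightarrow>
        f (permute_list \<sigma> xs) = of_int (sign \<sigma>) *\<^sub>R f xs)"

definition uniformly_bounded ::
    "'a::real_vector topology \<Rightarrow> nat \<Rightarrow> ('a list \<Rightarrow> 'a) set \<Rightarrow> bool" where
  "uniformly_bounded T n S \<longleftrightarrow>
     (\<forall>Bs. length Bs = n \<and> (\<forall>B\<in>set Bs. vn_bounded T B) \<longrightarrow>
        vn_bounded T {f xs | f xs. f \<in> S \<and> xs \<in> listset Bs})"

definition skew_maps :: "'a::real_vector topology \<Rightarrow> nat \<Rightarrow> ('a list \<Rightarrow> 'a) set" where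
  "skew_maps T n = {f. multilinear n f \<and> skew_symmetric n f \<and> uniformly_bounded T n {f}}"

definition skew_maps_topology :: "'a::real_vector topology \<Rightarrow> nat \<Rightarrow> ('a list \<Rightarrow> 'a) topology" where
  "skew_maps_topology T n =
     bornological_topology (skew_maps T n) {S. S \<subseteq> skew_maps T n \<and> uniformly_bounded T n S}"

section \<open>The Nijenhuis-Richardson bracket\<close>

text \<open>\<open>insertion m p K \<Phi>\<close> is \<open>i\<^sub>K \<Phi>\<close> for \<open>K\<close> in \<open>m\<close> arguments and \<open>\<Phi>\<close> in \<open>p\<close> arguments.\<close>

definition insertion :: "nat \<Rightarrow> nat \<Rightarrow> ('a::real_vector list \<Rightarrow> 'a) \<Rightarrow> ('a list \<Rightarrow> 'a) \<Rightarrow> 'a list \<Rightarrow> 'a"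
  where
  "insertion m p K \<Phi> =
     (\<lambda>vs. if p = 0 \<or> length vs \<noteq> m + (p - 1) then 0
       else (1 / (fact m * fact (p - 1))) *\<^sub>R
         (\<Sum>\<sigma> | \<sigma> permutes {..<m + (p - 1)}. of_int (sign \<sigma>) *\<^sub>R
            \<Phi> (K (take m (permute_list \<sigma> vs)) # drop m (permute_list \<sigma> vs))))"

text \<open>
  Below, \<open>k\<close> and \<open>l\<close> are degrees: an element of degree \<open>k \<ge> -1\<close> takes \<open>k + 1\<close> arguments, and the
  components of degree \<open>< -1\<close> vanish.
\<close>

definition nr_bracket ::
    "int \<Rightarrow> int \<Rightarrow> ('a::real_vector list \<Rightarrow> 'a) \<Rightarrow> ('a list \<Rightarrow> 'a) \<Rightarrow> 'a list \<Rightarrow> 'a" where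
  "nr_bracket k l K L =
     insertion (nat (k + 1)) (nat (l + 1)) K L
     - ((- 1) powi (k * l)) *\<^sub>R insertion (nat (l + 1)) (nat (k + 1)) L K"

definition nr_space :: "'a::real_vector topology \<Rightarrow> int \<Rightarrow> ('a list \<Rightarrow> 'a) set" where
  "nr_space T k = (if k < - 1 then {0} else skew_maps T (nat (k + 1)))"

section \<open>Graded Lie algebras\<close>

text \<open>
  A graded vector space is the family \<open>G\<close> of its homogeneous components; \<open>br k l\<close> is the
  restriction of the bracket to \<open>G k \<times> G l\<close>.
\<close>

definition graded_lie_algebra ::
    "(int \<Rightarrow> 'v::real_vector set) \<Rightarrow> (int \<Rightarrow> int \<Rightarrow> 'v \<Rightarrow> 'v \<Rightarrow> 'v) \<Rightarrow> bool" where
  "graded_lie_algebra G br \<longleftrightarrow>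
     (\<forall>k. subspace (G k)) \<and>
     (\<forall>k l. \<forall>x\<in>G k. \<forall>y\<in>G l. br k l x y \<in> G (k + l)) \<and>
     (\<forall>k l. \<forall>x\<in>G k. \<forall>x'\<in>G k. \<forall>y\<in>G l. \<forall>a b.
        br k l (a *\<^sub>R x + b *\<^sub>R x') y = a *\<^sub>R br k l x y + b *\<^sub>R br k l x' y) \<and>
     (\<forall>k l. \<forall>x\<in>G k. \<forall>y\<in>G l. \<forall>y'\<in>G l. \<forall>a b.
        br k l x (a *\<^sub>R y + b *\<^sub>R y') = a *\<^sub>R br k l x y + b *\<^sub>R br k l x y') \<and>
     (\<forall>k l. \<forall>x\<in>G k. \<forall>y\<in>G l. br k l x y = - (((- 1) powi (k * l)) *\<^sub>R br l k y x)) \<and>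
     (\<forall>k l m. \<forall>x\<in>G k. \<forall>y\<in>G l. \<forall>z\<in>G m.
        br k (l + m) x (br l m y z) =
          br (k + l) m (br k l x y) z + ((- 1) powi (k * l)) *\<^sub>R br l (k + m) y (br k m x z))"

definition graded_lie_subalgebra :: "(int \<Rightarrow> 'v::real_vector set) \<Rightarrow> (int \<Rightarrow> 'v set) \<Rightarrow>
    (int \<Rightarrow> int \<Rightarrow> 'v \<Rightarrow> 'v \<Rightarrow> 'v) \<Rightarrow> bool" where
  "graded_lie_subalgebra H G br \<longleftrightarrow>
     graded_lie_algebra G br \<and>
     (\<forall>k. subspace (H k) \<and> H k \<subseteq> G k) \<and>
     (\<forall>k l. \<forall>x\<in>H k. \<forall>y\<in>H l. br k l x y \<in> H (k + l))"

definition convenient_graded_lie_algebra :: "(int \<Rightarrow> 'v::real_vector set) \<Rightarrow>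
    (int \<Rightarrow> 'v topology) \<Rightarrow> (int \<Rightarrow> int \<Rightarrow> 'v \<Rightarrow> 'v \<Rightarrow> 'v) \<Rightarrow> bool" where
  "convenient_graded_lie_algebra G T br \<longleftrightarrow>
     graded_lie_algebra G br \<and>
     (\<forall>k. topspace (T k) = G k \<and> convenient_space (T k)) \<and>
     (\<forall>k l. bounded_binary (T k) (T l) (T (k + l)) (br k l))"

section \<open>Skew symmetric polyderivations\<close>

definition derivation :: "('a::real_vector \<Rightarrow> 'a \<Rightarrow> 'a) \<Rightarrow> ('a \<Rightarrow> 'a) \<Rightarrow> bool" where
  "derivation mul D \<longleftrightarrow> linear D \<and> (\<forall>a b. D (mul a b) = mul (D a) b + mul a (D b))"

definition polyderivations ::
    "'a::real_vector topology \<Rightarrow> ('a \<Rightarrow> 'a \<Rightarrow> 'a) \<Rightarrow> int \<Rightarrow> ('a list \<Rightarrow> 'a) set" where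
  "polyderivations T mul k =
     (if k < 0 then {0}
      else {K \<in> skew_maps T (nat (k + 1)).
              \<forall>as. length as = nat k \<longrightarrow> derivation mul (\<lambda>a. K (a # as))})"

definition polyderivations_topology ::
    "'a::real_vector topology \<Rightarrow> ('a \<Rightarrow> 'a \<Rightarrow> 'a) \<Rightarrow> int \<Rightarrow> ('a list \<Rightarrow> 'a) topology" where
  "polyderivations_topology T mul k =
     bornologification
       (subtopology (skew_maps_topology T (nat (k + 1))) (polyderivations T mul k))"

end

theory Submission
  imports Defs
begin

text \<open>
  The bracket is the graded commutator of the insertion product \<open>i\<^sub>K L\<close>, and the proof rests on a
  description of this product without permutations. Let \<open>contract v f\<close> be \<open>f\<close> with \<open>v\<close> put into its
  first slot. For \<open>K\<close> of degree \<open>k\<close>, splitting the permutations by the place that \<open>v\<close> is sent to gives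
  \<open>contract v (i\<^sub>K \<Phi>) = i\<^sub>C \<Phi> + (- 1)\<^sup>k i\<^sub>K (contract v \<Phi>)\<close> with \<open>C = contract v K\<close>. Together with the
  value on the empty list this determines \<open>i\<^sub>K \<Phi>\<close>, so it can be read as a definition by recursion
  over the arguments. That is \<open>ins\<close>, and \<open>insertion_eq_ins\<close> identifies it with the alternating sum.

  An identity between iterated insertions is now proved by induction over the list of arguments:
  contraction acts on both sides like a graded derivation, so the induction hypotheses for the
  contracted maps add up, and only the empty list has to be computed. In this way \<open>ins_pre_Lie\<close>
  shows that the associator \<open>i\<^sub>K i\<^sub>L M - i\<^sub>N M\<close> with \<open>N = i\<^sub>K L\<close> is graded symmetric in \<open>K\<close> and \<open>L\<close>. This is the
  graded pre-Lie identity, and the graded Jacobi identity of the commutator follows from it.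

  If \<open>K\<close> and \<open>L\<close> are derivations in each argument, then \<open>i\<^sub>K L\<close> in general is not, because \<open>L (K (a b, \<dots>), \<dots>)\<close> also
  produces the mixed terms \<open>K (a, \<dots>) L (b, \<dots>)\<close> and \<open>L (a, \<dots>) K (b, \<dots>)\<close>. Summed with their signs these
  are two cup products (\<open>ins_leibniz_defect\<close>). Exchanging \<open>K\<close> and \<open>L\<close> reproduces both of them, with
  the factors in the same order, up to the sign \<open>(- 1)\<^sup>k\<^sup>l\<close> (\<open>cup_flip\<close>). So they cancel in the bracket
  (\<open>bracket_leibniz\<close>).

  For the topologies, let \<open>V\<close> be a space of bounded skew symmetric maps that is closed under pointwise
  limits. In the bornological topology of its uniformly bounded subsets, these subsets are exactly
  the bounded ones, and \<open>V\<close> is a convenient space (\<open>vn_bounded_iff_uniformly_bounded\<close>,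
  \<open>convenient_function_space\<close>). Hence the bornologification of the topology which the polyderivations
  inherit is again of this kind. The bracket is bounded because it maps pairs of uniformly bounded
  families to such a family, which is one more induction over the arguments (\<open>bounded_ins\<close>).
\<close>

section \<open>Bornological topologies\<close>

lemma absolutely_convexD:
  assumes "absolutely_convex W" "x \<in> W" "y \<in> W" "\<bar>a\<bar> + \<bar>b\<bar> \<le> 1"
  shows "a *\<^sub>R x + b *\<^sub>R y \<in> W"
proof (cases "\<bar>a\<bar> + \<bar>b\<bar> = 0")
  case True
  then have "a = 0" "b = 0"
    by auto
  moreover have "0 *\<^sub>R x \<in> W"
    using assms(1,2) unfolding absolutely_convex_def by (metis abs_zero zero_le_one)
  ultimately show ?thesis
    by simp
next
  case False
  define s where "s = \<bar>a\<bar> + \<bar>b\<bar>"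
  have s: "s > 0" "s \<le> 1"
    using False assms(4) by (auto simp: s_def)
  have sgn: "sgn c *\<^sub>R z \<in> W" if "z \<in> W" for c :: real and z
    using assms(1) that by (auto simp: absolutely_convex_def sgn_if)
  have "(\<bar>a\<bar> / s) *\<^sub>R (sgn a *\<^sub>R x) + (\<bar>b\<bar> / s) *\<^sub>R (sgn b *\<^sub>R y) \<in> W"
    using assms(1) s by (intro convexD sgn assms(2,3))
      (auto simp: absolutely_convex_def s_def divide_simps)
  then have "s *\<^sub>R ((\<bar>a\<bar> / s) *\<^sub>R (sgn a *\<^sub>R x) + (\<bar>b\<bar> / s) *\<^sub>R (sgn b *\<^sub>R y)) \<in> W"
    using assms(1) s by (auto simp: absolutely_convex_def)
  then show ?thesis
    using s by (simp add: scaleR_add_right abs_mult_sgn)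
qed

lemma absolutely_convex_scale:
  "absolutely_convex W \<Longrightarrow> x \<in> W \<Longrightarrow> \<bar>c\<bar> \<le> 1 \<Longrightarrow> c *\<^sub>R x \<in> W"
  by (simp add: absolutely_convex_def)

lemma absorbs_iff:
  assumes "absolutely_convex W"
  shows "absorbs W B \<longleftrightarrow> (\<exists>e>0. \<forall>b\<in>B. e *\<^sub>R b \<in> W)"
proof
  assume "absorbs W B"
  then obtain r where r: "r > 0" "B \<subseteq> (*\<^sub>R) r ` W"
    unfolding absorbs_def by force
  then show "\<exists>e>0. \<forall>b\<in>B. e *\<^sub>R b \<in> W"
    by (intro exI[of _ "1 / r"]) auto
next
  assume "\<exists>e>0. \<forall>b\<in>B. e *\<^sub>R b \<in> W"
  then obtain e where e: "e > 0" "\<And>b. b \<in> B \<Longrightarrow> e *\<^sub>R b \<in> W"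
    by auto
  have "b \<in> (*\<^sub>R) c ` W" if "1 / e \<le> \<bar>c\<bar>" "b \<in> B" for c b
  proof -
    have c: "c \<noteq> 0" using that e(1) by auto
    have "1 \<le> \<bar>c\<bar> * e"
      using that(1) e(1) by (simp add: pos_divide_le_eq)
    then have "\<bar>1 / (c * e)\<bar> \<le> 1"
      using e(1) by (simp add: abs_mult)
    then have "(1 / (c * e)) *\<^sub>R (e *\<^sub>R b) \<in> W"
      by (rule absolutely_convex_scale[OF assms e(2)[OF that(2)]])
    moreover have "b = c *\<^sub>R ((1 / (c * e)) *\<^sub>R (e *\<^sub>R b))"
      using c e(1) by simp
    ultimately show ?thesis
      by (rule rev_image_eqI)
  qed
  then show "absorbs W B"
    unfolding absorbs_def using e(1) by (intro exI[of _ "1 / e"]) auto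
qed

text \<open>
  The discs are the basic neighbourhoods of \<open>0\<close> in \<open>bornological_topology V \<B>\<close>. All topological
  notions below are first expressed by discs, which reduces them to linear algebra.
\<close>

definition disc :: "'v::real_vector set \<Rightarrow> 'v set set \<Rightarrow> 'v set \<Rightarrow> bool" where
  "disc V \<B> W \<longleftrightarrow> W \<subseteq> V \<and> absolutely_convex W \<and> (\<forall>B\<in>\<B>. absorbs W B)"

lemma openin_disc:
  "openin (bornological_topology V \<B>) U \<longleftrightarrow>
     U \<subseteq> V \<and> (\<forall>x\<in>U. \<exists>W. disc V \<B> W \<and> (+) x ` W \<subseteq> U)"
  by (simp add: openin_bornological_topology disc_def conj_assoc)

text \<open>
  The members of \<open>\<B>\<close> contain all points, so discs absorb points. Without this a disc could be empty,
  and scalar multiplication could fail to be continuous.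
\<close>

locale bornology =
  fixes V :: "'v::real_vector set" and \<B> :: "'v set set"
  assumes subspace: "subspace V"
    and members: "\<And>B. B \<in> \<B> \<Longrightarrow> B \<subseteq> V"
    and singletons: "\<And>x. x \<in> V \<Longrightarrow> {x} \<in> \<B>"
begin

abbreviation "\<T> \<equiv> bornological_topology V \<B>"

lemma disc_absorbs_point:
  assumes "disc V \<B> W" "x \<in> V"
  obtains e where "e > 0" "\<And>c. \<bar>c\<bar> \<le> e \<Longrightarrow> c *\<^sub>R x \<in> W"
proof -
  have W: "absolutely_convex W"
    using assms(1) by (simp add: disc_def)
  obtain e where e: "e > 0" "e *\<^sub>R x \<in> W"
    using assms singletons[OF assms(2)] absorbs_iff[OF W] by (auto simp: disc_def)
  have "c *\<^sub>R x \<in> W" if "\<bar>c\<bar> \<le> e" for c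
    using absolutely_convex_scale[OF W e(2), of "c / e"] that e(1) by simp
  with e(1) show thesis
    by (rule that)
qed

lemma disc_zero: "disc V \<B> W \<Longrightarrow> 0 \<in> W"
  using disc_absorbs_point[of W 0] subspace_0[OF subspace] by (metis scaleR_zero_right abs_zero less_eq_real_def)

lemma disc_dilate:
  assumes "disc V \<B> W" "c > 0"
  shows "disc V \<B> ((*\<^sub>R) c ` W)"
proof -
  have W: "absolutely_convex W"
    using assms by (simp add: disc_def)
  have ac: "absolutely_convex ((*\<^sub>R) c ` W)"
    using W by (auto simp: absolutely_convex_def convex_scaling scaleR_left_commute[of _ c] simp del: scaleR_scaleR)
  have "absorbs ((*\<^sub>R) c ` W) B" if "B \<in> \<B>" for B
  proof -
    have "\<exists>e>0. \<forall>b\<in>B. e *\<^sub>R b \<in> W"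
      using assms that absorbs_iff[OF W] by (simp add: disc_def)
    then obtain e where "e > 0" "\<And>b. b \<in> B \<Longrightarrow> e *\<^sub>R b \<in> W"
      by blast
    then show ?thesis
      using assms(2) unfolding absorbs_iff[OF ac]
      by (intro exI[of _ "c * e"]) (auto simp flip: scaleR_scaleR)
  qed
  then show ?thesis
    using assms ac subspace by (auto simp: disc_def subspace_scale)
qed

lemma topspace: "topspace \<T> = V"
proof -
  have "absolutely_convex V"
    using subspace by (simp add: absolutely_convex_def subspace_imp_convex subspace_scale)
  then have "disc V \<B> V"
    using members by (auto simp: disc_def absorbs_iff subset_iff intro!: exI[of _ 1])
  then have "openin \<T> V"
    unfolding openin_disc using subspace by (auto simp: subspace_add)
  then show ?thesis
    by (metis openin_subset openin_topspace openin_disc subset_antisym)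
qed

text \<open>
  A disc \<open>W\<close> need not be open, but the union of the dilates \<open>t W\<close> with \<open>t < 1\<close> is: a point of \<open>t W\<close> can
  be moved by \<open>s W\<close> as long as \<open>t + s < 1\<close>, since \<open>t W + s W \<subseteq> (t + s) W\<close> by convexity.
\<close>

lemma open_core_disc:
  assumes W: "disc V \<B> W" and x: "x \<in> V"
  obtains U where "openin \<T> U" "x \<in> U" "U \<subseteq> (+) x ` W" "convex U"
proof
  have ac: "absolutely_convex W" and WV: "W \<subseteq> V"
    using W by (auto simp: disc_def)
  let ?C = "{t *\<^sub>R w | t w. 0 \<le> t \<and> t < 1 \<and> w \<in> W}"
  let ?U = "(+) x ` ?C"
  have "\<exists>W'. disc V \<B> W' \<and> (+) y ` W' \<subseteq> ?U" if "y \<in> ?U" for y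
  proof -
    obtain t w where t: "0 \<le> t" "t < 1" "w \<in> W" "y = x + t *\<^sub>R w"
      using \<open>y \<in> ?U\<close> by auto
    define s where "s = (1 - t) / 2"
    have s: "s > 0" "t + s < 1"
      using t by (auto simp: s_def field_simps)
    have "y + s *\<^sub>R v \<in> ?U" if v: "v \<in> W" for v
    proof -
      have "(t / (t + s)) *\<^sub>R w + (s / (t + s)) *\<^sub>R v \<in> W"
        using s t v by (intro absolutely_convexD[OF ac]) (auto simp: divide_simps)
      moreover have "y + s *\<^sub>R v = x + (t + s) *\<^sub>R ((t / (t + s)) *\<^sub>R w + (s / (t + s)) *\<^sub>R v)"
        using s t by (simp add: scaleR_add_right add.assoc)
      ultimately show ?thesis
        using s t by fastforce
    qed
    then show ?thesis
      using disc_dilate[OF W s(1)] by (intro exI[of _ "(*\<^sub>R) s ` W"]) auto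
  qed
  moreover have "?U \<subseteq> V"
    using x WV subspace by (auto intro!: subspace_add subspace_scale)
  ultimately show "openin \<T> ?U"
    unfolding openin_disc by blast
  show "x \<in> ?U"
    using disc_zero[OF W] by (auto intro!: image_eqI[of _ _ 0] exI[of _ 0])
  show "?U \<subseteq> (+) x ` W"
    using absolutely_convex_scale[OF ac] by auto
  have "convex ?C"
  proof (rule convexI)
    fix p q :: 'v and a b :: real
    assume pq: "p \<in> ?C" "q \<in> ?C" and ab: "0 \<le> a" "0 \<le> b" "a + b = 1"
    obtain t w s v where p: "0 \<le> t" "t < 1" "w \<in> W" "p = t *\<^sub>R w"
      and q: "0 \<le> s" "s < 1" "v \<in> W" "q = s *\<^sub>R v"
      using pq by blast
    define r where "r = a * t + b * s"
    have "r < 1"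
      unfolding r_def using p q ab
      by (metis convex_bound_lt)
    moreover have "0 \<le> r"
      using p q ab by (simp add: r_def)
    moreover have "\<exists>z\<in>W. a *\<^sub>R p + b *\<^sub>R q = r *\<^sub>R z"
    proof (cases "r = 0")
      case True
      then have ab0: "a * t = 0" "b * s = 0"
        using p q ab by (auto simp: r_def add_nonneg_eq_0_iff)
      moreover have "a *\<^sub>R p + b *\<^sub>R q = (a * t) *\<^sub>R w + (b * s) *\<^sub>R v"
        using p q by simp
      ultimately have "a *\<^sub>R p + b *\<^sub>R q = r *\<^sub>R w"
        by (simp only: ab0 True scaleR_zero_left add_0_left)
      then show ?thesis using p by blast
    next
      case False
      have "(a * t / r) *\<^sub>R w + (b * s / r) *\<^sub>R v \<in> W"
        using p q ab False \<open>0 \<le> r\<close>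
        by (intro absolutely_convexD[OF ac]) (auto simp: r_def abs_mult add_divide_distrib[symmetric])
      moreover have "a *\<^sub>R p + b *\<^sub>R q = r *\<^sub>R ((a * t / r) *\<^sub>R w + (b * s / r) *\<^sub>R v)"
        using p q False by (simp add: scaleR_add_right)
      ultimately show ?thesis by blast
    qed
    ultimately show "a *\<^sub>R p + b *\<^sub>R q \<in> ?C"
      by blast
  qed
  then show "convex ?U"
    by (rule convex_translation)
qed

lemma vn_bounded_iff:
  "vn_bounded \<T> B \<longleftrightarrow> B \<subseteq> V \<and> (\<forall>W. disc V \<B> W \<longrightarrow> (\<exists>e>0. \<forall>b\<in>B. e *\<^sub>R b \<in> W))"
proof
  assume B: "vn_bounded \<T> B"
  have "\<exists>e>0. \<forall>b\<in>B. e *\<^sub>R b \<in> W" if W: "disc V \<B> W" for W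
  proof -
    obtain U where U: "openin \<T> U" "0 \<in> U" "U \<subseteq> (+) 0 ` W"
      using open_core_disc[OF W subspace_0[OF subspace]] by metis
    then obtain r where r: "r > 0" "B \<subseteq> (*\<^sub>R) r ` U"
      using B unfolding vn_bounded_def absorbs_def by force
    have "U \<subseteq> W"
      using U(3) by simp
    with r show ?thesis
      by (intro exI[of _ "1 / r"]) fastforce
  qed
  with B show "B \<subseteq> V \<and> (\<forall>W. disc V \<B> W \<longrightarrow> (\<exists>e>0. \<forall>b\<in>B. e *\<^sub>R b \<in> W))"
    by (simp add: vn_bounded_def topspace)
next
  assume B: "B \<subseteq> V \<and> (\<forall>W. disc V \<B> W \<longrightarrow> (\<exists>e>0. \<forall>b\<in>B. e *\<^sub>R b \<in> W))"
  have "absorbs U B" if U: "openin \<T> U" "0 \<in> U" for U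
  proof -
    obtain W where W: "disc V \<B> W" "(+) 0 ` W \<subseteq> U"
      using U unfolding openin_disc by blast
    then have "absorbs W B"
      using B absorbs_iff[of W B] by (simp add: disc_def)
    moreover have "W \<subseteq> U"
      using W(2) by simp
    ultimately show ?thesis
      unfolding absorbs_def by (meson image_mono order_trans)
  qed
  with B show "vn_bounded \<T> B"
    by (simp add: vn_bounded_def topspace)
qed

lemma members_bounded: "B \<in> \<B> \<Longrightarrow> vn_bounded \<T> B"
  unfolding vn_bounded_iff using members absorbs_iff by (metis disc_def)

lemma limitin_iff:
  "limitin \<T> x l sequentially \<longleftrightarrow>
     l \<in> V \<and> (\<forall>W. disc V \<B> W \<longrightarrow> (\<forall>\<^sub>F n in sequentially. x n - l \<in> W))"
proof
  assume lim: "limitin \<T> x l sequentially"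
  then have l: "l \<in> V"
    by (simp add: limitin_def topspace)
  have "\<forall>\<^sub>F n in sequentially. x n - l \<in> W" if W: "disc V \<B> W" for W
  proof -
    obtain U where "openin \<T> U" "l \<in> U" and U: "U \<subseteq> (+) l ` W"
      using open_core_disc[OF W l] by metis
    then have "\<forall>\<^sub>F n in sequentially. x n \<in> U"
      using lim by (simp add: limitin_def)
    then show ?thesis
      by (rule eventually_mono) (use U in fastforce)
  qed
  with l show "l \<in> V \<and> (\<forall>W. disc V \<B> W \<longrightarrow> (\<forall>\<^sub>F n in sequentially. x n - l \<in> W))"
    by blast
next
  assume r: "l \<in> V \<and> (\<forall>W. disc V \<B> W \<longrightarrow> (\<forall>\<^sub>F n in sequentially. x n - l \<in> W))"
  have "\<forall>\<^sub>F n in sequentially. x n \<in> U" if U: "openin \<T> U" "l \<in> U" for U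
  proof -
    obtain W where W: "disc V \<B> W" "(+) l ` W \<subseteq> U"
      using U unfolding openin_disc by blast
    with r have "\<forall>\<^sub>F n in sequentially. x n - l \<in> W"
      by blast
    then show ?thesis
      by (rule eventually_mono) (use W(2) in \<open>force\<close>)
  qed
  with r show "limitin \<T> x l sequentially"
    by (simp add: limitin_def topspace)
qed

text \<open>
  Continuity of the operations is the usual splitting of a disc \<open>W\<close> into two halves. For the
  product \<open>d q\<close> near \<open>c x\<close> the difference is \<open>(d - c) x + d (q - x)\<close>. The first term is small because \<open>W\<close>
  absorbs \<open>x\<close>, and the second because \<open>\<bar>d\<bar>\<close> stays below a fixed bound \<open>r\<close>.
\<close>

lemma locally_convex: "locally_convex_space \<T>"
  unfolding locally_convex_space_def
proof (intro conjI allI impI)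
  show "subspace (topspace \<T>)"
    by (simp add: topspace subspace)
  have half: "disc V \<B> ((*\<^sub>R) (1/2) ` W)" if "disc V \<B> W" for W
    using disc_dilate[OF that] by simp
  show "continuous_map (prod_topology \<T> \<T>) \<T> (\<lambda>(x, y). x + y)"
    unfolding continuous_map_def
  proof (intro conjI allI impI)
    show "(\<lambda>(x, y). x + y) \<in> topspace (prod_topology \<T> \<T>) \<rightarrow> topspace \<T>"
      using subspace by (auto simp: topspace subspace_add)
    fix U assume U: "openin \<T> U"
    let ?S = "{z \<in> topspace (prod_topology \<T> \<T>). (\<lambda>(x, y). x + y) z \<in> U}"
    show "openin (prod_topology \<T> \<T>) ?S"
      unfolding openin_prod_topology_alt
    proof (intro allI impI)
      fix x y assume "(x, y) \<in> ?S"
      then have xy: "x \<in> V" "y \<in> V" "x + y \<in> U"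
        by (auto simp: topspace)
      then obtain W where W: "disc V \<B> W" "(+) (x + y) ` W \<subseteq> U"
        using U unfolding openin_disc by blast
      obtain P where P: "openin \<T> P" "x \<in> P" "P \<subseteq> (+) x ` (*\<^sub>R) (1/2) ` W"
        using open_core_disc[OF half[OF W(1)] xy(1)] by metis
      obtain Q where Q: "openin \<T> Q" "y \<in> Q" "Q \<subseteq> (+) y ` (*\<^sub>R) (1/2) ` W"
        using open_core_disc[OF half[OF W(1)] xy(2)] by metis
      have "p + q \<in> U" if pq: "p \<in> P" "q \<in> Q" for p q
      proof -
        obtain u v where uv: "u \<in> W" "v \<in> W" "p = x + (1/2) *\<^sub>R u" "q = y + (1/2) *\<^sub>R v"
          using pq P(3) Q(3) by blast
        have "(1/2) *\<^sub>R u + (1/2) *\<^sub>R v \<in> W"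
          using W(1) uv by (intro absolutely_convexD) (auto simp: disc_def)
        then have "(x + y) + ((1/2) *\<^sub>R u + (1/2) *\<^sub>R v) \<in> U"
          using W(2) by blast
        then show ?thesis
          using uv by (simp add: algebra_simps)
      qed
      then have "P \<times> Q \<subseteq> ?S"
        using openin_subset[OF P(1)] openin_subset[OF Q(1)] by auto
      with P(1,2) Q(1,2) show "\<exists>P Q. openin \<T> P \<and> openin \<T> Q \<and> x \<in> P \<and> y \<in> Q \<and> P \<times> Q \<subseteq> ?S"
        by blast
    qed
  qed
  show "continuous_map (prod_topology euclideanreal \<T>) \<T> (\<lambda>(c, x). c *\<^sub>R x)"
    unfolding continuous_map_def
  proof (intro conjI allI impI)
    show "(\<lambda>(c, x). c *\<^sub>R x) \<in> topspace (prod_topology euclideanreal \<T>) \<rightarrow> topspace \<T>"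
      using subspace by (auto simp: topspace subspace_scale)
    fix U assume U: "openin \<T> U"
    let ?S = "{z \<in> topspace (prod_topology euclideanreal \<T>). (\<lambda>(c, x). c *\<^sub>R x) z \<in> U}"
    show "openin (prod_topology euclideanreal \<T>) ?S"
      unfolding openin_prod_topology_alt
    proof (intro allI impI)
      fix c x assume "(c, x) \<in> ?S"
      then have cx: "x \<in> V" "c *\<^sub>R x \<in> U"
        by (auto simp: topspace)
      then obtain W where W: "disc V \<B> W" "(+) (c *\<^sub>R x) ` W \<subseteq> U"
        using U unfolding openin_disc by blast
      have ac: "absolutely_convex W"
        using W(1) by (simp add: disc_def)
      obtain e where e: "e > 0" "\<And>d. \<bar>d\<bar> \<le> e \<Longrightarrow> d *\<^sub>R x \<in> W"
        using disc_absorbs_point[OF W(1) cx(1)] by metis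
      define r where "r = \<bar>c\<bar> + e"
      have r: "r > 0" and "0 < 1 / (2 * r)"
        using e by (simp_all add: r_def)
      obtain Q where Q: "openin \<T> Q" "x \<in> Q" "Q \<subseteq> (+) x ` (*\<^sub>R) (1 / (2 * r)) ` W"
        using open_core_disc[OF disc_dilate[OF W(1) \<open>0 < 1 / (2 * r)\<close>] cx(1)] by metis
      have "d *\<^sub>R q \<in> U" if dq: "d \<in> ball c (e / 2)" "q \<in> Q" for d q
      proof -
        obtain u where u: "u \<in> W" "q = x + (1 / (2 * r)) *\<^sub>R u"
          using dq Q(3) by blast
        have dc: "\<bar>d - c\<bar> < e / 2"
          using dq(1) by (simp add: dist_real_def abs_minus_commute)
        then have "\<bar>d\<bar> \<le> r"
          unfolding r_def using e(1) by linarith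
        have A: "((d - c) / e) *\<^sub>R (e *\<^sub>R x) + (d / (2 * r)) *\<^sub>R u \<in> W"
        proof (rule absolutely_convexD[OF ac])
          show "e *\<^sub>R x \<in> W"
            using e by simp
          have "\<bar>(d - c) / e\<bar> \<le> 1/2" "\<bar>d / (2 * r)\<bar> \<le> 1/2"
            using dc e(1) r \<open>\<bar>d\<bar> \<le> r\<close> by (simp_all add: abs_mult pos_divide_le_eq)
          then show "\<bar>(d - c) / e\<bar> + \<bar>d / (2 * r)\<bar> \<le> 1"
            by linarith
        qed (rule u(1))
        have eq: "d *\<^sub>R q = c *\<^sub>R x + (((d - c) / e) *\<^sub>R (e *\<^sub>R x) + (d / (2 * r)) *\<^sub>R u)"
          using e(1) u(2) by (simp add: scaleR_add_right scaleR_diff_left)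
        have "c *\<^sub>R x + (((d - c) / e) *\<^sub>R (e *\<^sub>R x) + (d / (2 * r)) *\<^sub>R u) \<in> U"
          using A W(2) by blast
        then show ?thesis
          unfolding eq .
      qed
      then have "ball c (e / 2) \<times> Q \<subseteq> ?S"
        using openin_subset[OF Q(1)] by auto
      with Q(1,2) e(1) show "\<exists>P Q. openin euclideanreal P \<and> openin \<T> Q \<and> c \<in> P \<and> x \<in> Q \<and> P \<times> Q \<subseteq> ?S"
        by (intro exI[of _ "ball c (e / 2)"] exI[of _ Q]) simp
    qed
  qed
  fix U assume "openin \<T> U \<and> 0 \<in> U"
  then obtain W where W: "disc V \<B> W" "(+) 0 ` W \<subseteq> U"
    unfolding openin_disc by blast
  obtain P where P: "openin \<T> P" "0 \<in> P" "P \<subseteq> (+) 0 ` W" "convex P"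
    by (rule open_core_disc[OF W(1) subspace_0[OF subspace]])
  moreover have "P \<subseteq> U"
    using P(3) W(2) by (rule subset_trans)
  ultimately show "\<exists>W. openin \<T> W \<and> 0 \<in> W \<and> W \<subseteq> U \<and> convex W"
    by (intro exI[of _ P]) simp
qed

lemma Hausdorff_iff:
  "Hausdorff_space \<T> \<longleftrightarrow> (\<forall>x\<in>V. x \<noteq> 0 \<longrightarrow> (\<exists>W. disc V \<B> W \<and> x \<notin> W))"
proof
  assume H: "Hausdorff_space \<T>"
  show "\<forall>x\<in>V. x \<noteq> 0 \<longrightarrow> (\<exists>W. disc V \<B> W \<and> x \<notin> W)"
  proof (intro ballI impI)
    fix x assume "x \<in> V" "x \<noteq> 0"
    then obtain P Q where "openin \<T> P" "0 \<in> P" "x \<in> Q" "disjnt P Q"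
      using H subspace_0[OF subspace] unfolding Hausdorff_space_def topspace by metis
    then obtain W where "disc V \<B> W" "(+) 0 ` W \<subseteq> P"
      unfolding openin_disc by blast
    with \<open>x \<in> Q\<close> \<open>disjnt P Q\<close> show "\<exists>W. disc V \<B> W \<and> x \<notin> W"
      by (auto simp: disjnt_def)
  qed
next
  assume sep: "\<forall>x\<in>V. x \<noteq> 0 \<longrightarrow> (\<exists>W. disc V \<B> W \<and> x \<notin> W)"
  show "Hausdorff_space \<T>"
    unfolding Hausdorff_space_def topspace
  proof (intro allI impI)
    fix x y assume xy: "x \<in> V \<and> y \<in> V \<and> x \<noteq> y"
    then have "x - y \<in> V" "x - y \<noteq> 0"
      using subspace by (auto simp: subspace_diff)
    then obtain W where W: "disc V \<B> W" "x - y \<notin> W"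
      using sep by blast
    have half: "disc V \<B> ((*\<^sub>R) (1/2) ` W)"
      using disc_dilate[OF W(1)] by simp
    obtain P where P: "openin \<T> P" "x \<in> P" "P \<subseteq> (+) x ` (*\<^sub>R) (1/2) ` W"
      using open_core_disc[OF half] xy by metis
    obtain Q where Q: "openin \<T> Q" "y \<in> Q" "Q \<subseteq> (+) y ` (*\<^sub>R) (1/2) ` W"
      using open_core_disc[OF half] xy by metis
    have "False" if z: "z \<in> P" "z \<in> Q" for z
    proof -
      obtain u v where uv: "u \<in> W" "v \<in> W" "z = x + (1/2) *\<^sub>R u" "z = y + (1/2) *\<^sub>R v"
        using z P(3) Q(3) by blast
      have "(1/2) *\<^sub>R v + (-1/2) *\<^sub>R u \<in> W"
        using W(1) uv by (intro absolutely_convexD) (auto simp: disc_def)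
      moreover have "x + (1/2) *\<^sub>R u = y + (1/2) *\<^sub>R v"
        using uv by simp
      then have "x - y = (1/2) *\<^sub>R v + (-1/2) *\<^sub>R u"
        by (simp add: algebra_simps)
      ultimately show False
        using W(2) by simp
    qed
    with P Q show "\<exists>P Q. openin \<T> P \<and> openin \<T> Q \<and> x \<in> P \<and> y \<in> Q \<and> disjnt P Q"
      by (meson disjnt_iff)
  qed
qed

end

section \<open>Bounded sets and limits in a convenient vector space\<close>

lemma scaleR_fun_apply: "(c *\<^sub>R f) x = c *\<^sub>R f x"
  by (simp add: scaleR_fun_def)

lemma singleton_bounded:
  assumes "locally_convex_space T" "x \<in> topspace T"
  shows "vn_bounded T {x}"
proof -
  have "absorbs U {x}" if U: "openin T U" "0 \<in> U" for U
  proof -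
    have "continuous_map euclideanreal T (\<lambda>c. c *\<^sub>R x)"
    proof -
      have "continuous_map euclideanreal (prod_topology euclideanreal T) (\<lambda>c. (c, x))"
        using assms(2) by (auto simp: continuous_map_pairedI)
      moreover have "continuous_map (prod_topology euclideanreal T) T (\<lambda>(c, x). c *\<^sub>R x)"
        using assms(1) by (simp add: locally_convex_space_def)
      ultimately have "continuous_map euclideanreal T ((\<lambda>(c, x). c *\<^sub>R x) \<circ> (\<lambda>c. (c, x)))"
        by (rule continuous_map_compose)
      then show ?thesis
        by (simp add: o_def)
    qed
    then have "open {c. c *\<^sub>R x \<in> U}"
      using U(1) by (auto simp: continuous_map_def)
    moreover have "0 \<in> {c. c *\<^sub>R x \<in> U}"
      using U(2) by simp
    ultimately obtain d where d: "d > 0" "ball 0 d \<subseteq> {c. c *\<^sub>R x \<in> U}"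
      by (metis open_contains_ball)
    have "x \<in> (*\<^sub>R) c ` U" if c: "2 / d \<le> \<bar>c\<bar>" for c
    proof -
      have "c \<noteq> 0"
        using c d(1) by auto
      then have "1 / c \<in> ball 0 d"
        using c d(1) by (simp add: dist_real_def field_simps)
      then have "(1 / c) *\<^sub>R x \<in> U"
        using d(2) by blast
      then show ?thesis
        using \<open>c \<noteq> 0\<close> by (intro image_eqI[of _ _ "(1 / c) *\<^sub>R x"]) auto
    qed
    then show ?thesis
      unfolding absorbs_def using d(1) by (intro exI[of _ "2 / d"]) auto
  qed
  with assms(2) show ?thesis
    by (simp add: vn_bounded_def)
qed

text \<open>
  A convenient space carries the bornological topology of its own bounded sets, so the description
  by discs applies to it as well.
\<close>

locale convenient_base =
  fixes T :: "'a::real_vector topology"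
  assumes topspace: "topspace T = UNIV"
    and convenient: "convenient_space T"
begin

lemma bornological: "bornological_topology UNIV {B. vn_bounded T B} = T"
  using convenient topspace by (simp add: convenient_space_def bornologification_def)

sublocale B: bornology UNIV "{B. vn_bounded T B}"
  rewrites "bornological_topology UNIV {B. vn_bounded T B} = T"
proof -
  show "bornology UNIV {B. vn_bounded T B}"
    using convenient by unfold_locales (auto simp: convenient_space_def topspace intro: singleton_bounded)
qed (rule bornological)

text \<open>
  A constant of its own, because \<open>bounded_disc\<close> below describes the bounded sets by discs while
  discs are defined by the bounded sets: unfolding it must not create new instances of itself.
\<close>

definition zero_disc :: "'a set \<Rightarrow> bool" where
  "zero_disc = disc UNIV {B. vn_bounded T B}"

lemma zero_disc_iff:
  "zero_disc W \<longleftrightarrow> absolutely_convex W \<and> (\<forall>B. vn_bounded T B \<longrightarrow> absorbs W B)"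
  by (simp add: zero_disc_def disc_def)

lemma bounded_disc:
  "vn_bounded T B \<longleftrightarrow> (\<forall>W. zero_disc W \<longrightarrow> (\<exists>e>0. \<forall>b\<in>B. e *\<^sub>R b \<in> W))"
  using B.vn_bounded_iff[of B] by (simp only: zero_disc_def subset_UNIV simp_thms)

lemma zero_discD: "zero_disc W \<Longrightarrow> absolutely_convex W"
  by (simp add: zero_disc_iff)

lemma bounded_subset: "vn_bounded T C \<Longrightarrow> B \<subseteq> C \<Longrightarrow> vn_bounded T B"
  unfolding bounded_disc by blast

lemma bounded_singleton: "vn_bounded T {x}"
  using convenient by (intro singleton_bounded) (simp_all add: convenient_space_def topspace)

lemma bounded_add:
  assumes "vn_bounded T B" "vn_bounded T C"
  shows "vn_bounded T {x + y | x y. x \<in> B \<and> y \<in> C}"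
  unfolding bounded_disc
proof (intro allI impI)
  fix W assume W: "zero_disc W"
  obtain d e where de: "d > 0" "\<And>b. b \<in> B \<Longrightarrow> d *\<^sub>R b \<in> W" "e > 0" "\<And>b. b \<in> C \<Longrightarrow> e *\<^sub>R b \<in> W"
    using assms W unfolding bounded_disc by meson
  define r where "r = min d e / 2"
  have r: "r > 0" "r / d \<le> 1/2" "r / e \<le> 1/2"
    using de(1,3) by (auto simp: r_def field_simps)
  have "r / d + r / e \<le> 1"
    using r(2,3) by linarith
  then have sum: "\<bar>r / d\<bar> + \<bar>r / e\<bar> \<le> 1"
    using r(1) de(1,3) by simp
  have "r *\<^sub>R (x + y) \<in> W" if "x \<in> B" "y \<in> C" for x y
  proof -
    have "(r / d) *\<^sub>R (d *\<^sub>R x) + (r / e) *\<^sub>R (e *\<^sub>R y) \<in> W"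
      by (rule absolutely_convexD[OF zero_discD[OF W] de(2)[OF that(1)] de(4)[OF that(2)] sum])
    then show ?thesis
      using de by (simp add: scaleR_add_right)
  qed
  with r(1) show "\<exists>e>0. \<forall>b\<in>{x + y | x y. x \<in> B \<and> y \<in> C}. e *\<^sub>R b \<in> W"
    by blast
qed

lemma bounded_scale:
  assumes "vn_bounded T B"
  shows "vn_bounded T ((*\<^sub>R) c ` B)"
  unfolding bounded_disc
proof (intro allI impI)
  fix W assume W: "zero_disc W"
  obtain e where e: "e > 0" "\<And>b. b \<in> B \<Longrightarrow> e *\<^sub>R b \<in> W"
    using assms W unfolding bounded_disc by meson
  define r where "r = e / (\<bar>c\<bar> + 1)"
  have r: "r > 0"
    using e(1) by (simp add: r_def)
  have "r *\<^sub>R (c *\<^sub>R x) \<in> W" if "x \<in> B" for x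
  proof -
    have "(c / (\<bar>c\<bar> + 1)) *\<^sub>R (e *\<^sub>R x) \<in> W"
      by (rule absolutely_convex_scale[OF zero_discD[OF W]]) (use e that in auto)
    then show ?thesis
      by (simp add: r_def ac_simps)
  qed
  with r show "\<exists>e>0. \<forall>b\<in>(*\<^sub>R) c ` B. e *\<^sub>R b \<in> W"
    by blast
qed

lemma limitin_disc:
  "limitin T x l sequentially \<longleftrightarrow> (\<forall>W. zero_disc W \<longrightarrow> (\<forall>\<^sub>F n in sequentially. x n - l \<in> W))"
  using B.limitin_iff[of x l] by (simp only: zero_disc_def UNIV_I simp_thms)

lemma limit_unique: "limitin T x l sequentially \<Longrightarrow> limitin T x l' sequentially \<Longrightarrow> l = l'"
  using convenient by (auto simp: convenient_space_def intro: limitin_Hausdorff_unique)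

lemma limit_const: "limitin T (\<lambda>n. l) l sequentially"
  by (simp add: topspace)

lemma limit_add:
  assumes "limitin T x l sequentially" "limitin T y m sequentially"
  shows "limitin T (\<lambda>n. x n + y n) (l + m) sequentially"
  unfolding limitin_disc
proof (intro allI impI)
  fix W assume W: "zero_disc W"
  have "zero_disc ((*\<^sub>R) (1/2) ` W)"
    using W unfolding zero_disc_def by (rule B.disc_dilate) simp
  then have "\<forall>\<^sub>F n in sequentially. x n - l \<in> (*\<^sub>R) (1/2) ` W \<and> y n - m \<in> (*\<^sub>R) (1/2) ` W"
    using assms unfolding limitin_disc by (intro eventually_conj) blast+
  then show "\<forall>\<^sub>F n in sequentially. x n + y n - (l + m) \<in> W"
  proof (rule eventually_mono)
    fix n assume "x n - l \<in> (*\<^sub>R) (1/2) ` W \<and> y n - m \<in> (*\<^sub>R) (1/2) ` W"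
    then obtain u v where uv: "x n - l = (1/2) *\<^sub>R u" "y n - m = (1/2) *\<^sub>R v" "u \<in> W" "v \<in> W"
      by blast
    then have "(1/2) *\<^sub>R u + (1/2) *\<^sub>R v \<in> W"
      by (intro absolutely_convexD[OF zero_discD[OF W]]) auto
    then show "x n + y n - (l + m) \<in> W"
      using uv(1,2) by (simp add: algebra_simps)
  qed
qed

text \<open>
  A bounded linear map is continuous on a bornological space: the preimage of a disc is absolutely
  convex and absorbs bounded sets, hence is a disc.
\<close>

lemma limit_linear:
  assumes "linear D" and bounded: "\<And>B. vn_bounded T B \<Longrightarrow> vn_bounded T (D ` B)"
    and lim: "limitin T x l sequentially"
  shows "limitin T (\<lambda>n. D (x n)) (D l) sequentially"
  unfolding limitin_disc
proof (intro allI impI)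
  fix W assume W: "zero_disc W"
  have ac: "absolutely_convex (D -` W)"
    using zero_discD[OF W] convex_linear_vimage[OF \<open>linear D\<close>, of W]
    by (simp add: absolutely_convex_def linear_scale[OF \<open>linear D\<close>])
  have "absorbs (D -` W) B" if B: "vn_bounded T B" for B
  proof -
    obtain e where "e > 0" "\<And>b. b \<in> D ` B \<Longrightarrow> e *\<^sub>R b \<in> W"
      using bounded[OF B] W unfolding bounded_disc by blast
    then show ?thesis
      unfolding absorbs_iff[OF ac]
      by (intro exI[of _ e]) (simp add: linear_scale[OF \<open>linear D\<close>])
  qed
  then have "zero_disc (D -` W)"
    using ac by (simp add: zero_disc_iff)
  then have "\<forall>\<^sub>F n in sequentially. x n - l \<in> D -` W"
    using lim unfolding limitin_disc by blast
  then show "\<forall>\<^sub>F n in sequentially. D (x n) - D l \<in> W"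
    by (rule eventually_mono) (simp add: linear_diff[OF \<open>linear D\<close>])
qed

lemma limit_scale:
  "limitin T x l sequentially \<Longrightarrow> limitin T (\<lambda>n. c *\<^sub>R x n) (c *\<^sub>R l) sequentially"
  by (rule limit_linear[OF linear_scaleR bounded_scale])

text \<open>
  This replaces the closure of a bounded set. It suffices that a limit differs by an element of \<open>W\<close>
  from some member of the sequence.
\<close>

lemma bounded_limits:
  assumes "vn_bounded T B"
  shows "vn_bounded T {l. \<exists>x. range x \<subseteq> B \<and> limitin T x l sequentially}"
  unfolding bounded_disc
proof (intro allI impI)
  fix W assume W: "zero_disc W"
  obtain e where e: "e > 0" "\<And>b. b \<in> B \<Longrightarrow> e *\<^sub>R b \<in> W"
    using assms W unfolding bounded_disc by meson
  define r where "r = min e 1 / 2"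
  have r: "r > 0" "r \<le> 1/2" "r / e \<le> 1/2"
    using e(1) by (auto simp: r_def field_simps)
  have "r / e + r \<le> 1"
    using r(2,3) by linarith
  then have sum: "\<bar>r / e\<bar> + \<bar>- r\<bar> \<le> 1"
    using r(1) e(1) by simp
  have "r *\<^sub>R l \<in> W" if x: "range x \<subseteq> B" "limitin T x l sequentially" for x l
  proof -
    obtain n where n: "x n - l \<in> W"
      using x(2) W unfolding limitin_disc eventually_sequentially by blast
    have "(r / e) *\<^sub>R (e *\<^sub>R x n) + (- r) *\<^sub>R (x n - l) \<in> W"
      using x(1) n by (intro absolutely_convexD[OF zero_discD[OF W] _ _ sum] e(2)) auto
    then show ?thesis
      using e(1) by (simp add: scaleR_diff_right)
  qed
  with r(1) show "\<exists>e>0. \<forall>b\<in>{l. \<exists>x. range x \<subseteq> B \<and> limitin T x l sequentially}. e *\<^sub>R b \<in> W"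
    by blast
qed

lemma uniformly_boundedD:
  "uniformly_bounded T n S \<Longrightarrow> length Bs = n \<Longrightarrow> \<forall>B\<in>set Bs. vn_bounded T B \<Longrightarrow>
     vn_bounded T {f xs | f xs. f \<in> S \<and> xs \<in> listset Bs}"
  unfolding uniformly_bounded_def by blast

lemma uniformly_bounded_subset:
  "uniformly_bounded T n S \<Longrightarrow> S' \<subseteq> S \<Longrightarrow> uniformly_bounded T n S'"
  unfolding uniformly_bounded_def by (fast elim: bounded_subset)

lemma uniformly_bounded_add:
  assumes "uniformly_bounded T n S" "uniformly_bounded T n S'"
  shows "uniformly_bounded T n {f + g | f g. f \<in> S \<and> g \<in> S'}"
  unfolding uniformly_bounded_def
proof (intro allI impI, elim conjE)
  fix Bs assume "length Bs = n" "\<forall>B\<in>set Bs. vn_bounded T B"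
  then have "vn_bounded T {x + y | x y. x \<in> {f xs | f xs. f \<in> S \<and> xs \<in> listset Bs}
      \<and> y \<in> {f xs | f xs. f \<in> S' \<and> xs \<in> listset Bs}}"
    using assms by (intro bounded_add uniformly_boundedD)
  then show "vn_bounded T {f xs | f xs. f \<in> {f + g | f g. f \<in> S \<and> g \<in> S'} \<and> xs \<in> listset Bs}"
    by (rule bounded_subset) fastforce
qed

lemma uniformly_bounded_scale:
  assumes "uniformly_bounded T n S"
  shows "uniformly_bounded T n ((*\<^sub>R) c ` S)"
  unfolding uniformly_bounded_def
proof (intro allI impI, elim conjE)
  fix Bs assume "length Bs = n" "\<forall>B\<in>set Bs. vn_bounded T B"
  then have "vn_bounded T ((*\<^sub>R) c ` {f xs | f xs. f \<in> S \<and> xs \<in> listset Bs})"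
    using assms by (intro bounded_scale uniformly_boundedD)
  then show "vn_bounded T {f xs | f xs. f \<in> (*\<^sub>R) c ` S \<and> xs \<in> listset Bs}"
    by (rule bounded_subset) (fastforce simp: scaleR_fun_apply)
qed

lemma uniformly_bounded_limits:
  assumes "uniformly_bounded T n S"
  shows "uniformly_bounded T n {g. \<exists>h. range h \<subseteq> S \<and>
    (\<forall>xs. limitin T (\<lambda>m. h m xs) (g xs) sequentially)}" (is "uniformly_bounded T n ?L")
  unfolding uniformly_bounded_def
proof (intro allI impI, elim conjE)
  fix Bs assume "length Bs = n" "\<forall>B\<in>set Bs. vn_bounded T B"
  then have "vn_bounded T {l. \<exists>x. range x \<subseteq> {f xs | f xs. f \<in> S \<and> xs \<in> listset Bs} \<and>
      limitin T x l sequentially}"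
    using assms by (intro bounded_limits uniformly_boundedD)
  then show "vn_bounded T {f xs | f xs. f \<in> ?L \<and> xs \<in> listset Bs}"
  proof (rule bounded_subset, intro subsetI)
    fix y assume "y \<in> {f xs | f xs. f \<in> ?L \<and> xs \<in> listset Bs}"
    then obtain g xs h where "y = g xs" "xs \<in> listset Bs" "range h \<subseteq> S"
      "limitin T (\<lambda>m. h m xs) (g xs) sequentially"
      by blast
    then show "y \<in> {l. \<exists>x. range x \<subseteq> {f xs | f xs. f \<in> S \<and> xs \<in> listset Bs} \<and>
        limitin T x l sequentially}"
      by (intro CollectI exI[of _ "\<lambda>m. h m xs"]) blast
  qed
qed

lemma listset_singletons: "listset (map (\<lambda>x. {x}) xs) = {xs}"
  by (induction xs) (auto simp: set_Cons_def)

lemma bounded_evaluation: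
  assumes "S \<subseteq> skew_maps T n" "uniformly_bounded T n S"
  shows "vn_bounded T {f xs | f. f \<in> S}"
proof (cases "length xs = n")
  case True
  then have "vn_bounded T {f ys | f ys. f \<in> S \<and> ys \<in> listset (map (\<lambda>x. {x}) xs)}"
    using bounded_singleton by (intro uniformly_boundedD[OF assms(2)]) auto
  then show ?thesis
    by (simp add: listset_singletons)
next
  case False
  then have "{f xs | f. f \<in> S} \<subseteq> {0}"
    using assms(1) by (auto simp: skew_maps_def multilinear_def)
  then show ?thesis
    by (rule bounded_subset[OF bounded_singleton])
qed

lemma subspace_skew_maps: "subspace (skew_maps T n)"
proof (rule subspaceI)
  have "vn_bounded T {0 xs | xs. xs \<in> A}" for A :: "'a list set"
    by (rule bounded_subset[OF bounded_singleton[of 0]]) auto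
  then show "0 \<in> skew_maps T n"
    by (auto simp: skew_maps_def multilinear_def skew_symmetric_def uniformly_bounded_def
        linear_zero intro!: module_hom_zero)
next
  fix f g :: "'a list \<Rightarrow> 'a" assume "f \<in> skew_maps T n" "g \<in> skew_maps T n"
  then show "f + g \<in> skew_maps T n"
    using uniformly_bounded_add[of n "{f}" "{g}"]
    by (auto simp: skew_maps_def multilinear_def skew_symmetric_def scaleR_add_right
        intro: linear_compose_add)
next
  fix f :: "'a list \<Rightarrow> 'a" and c assume "f \<in> skew_maps T n"
  then show "c *\<^sub>R f \<in> skew_maps T n"
    using uniformly_bounded_scale[of n "{f}" c]
    by (auto simp: skew_maps_def multilinear_def skew_symmetric_def scaleR_fun_apply
        intro: linear_compose_scale_right)
qed

text \<open>
  The algebraic conditions are equations between values and pass to pointwise limits. Boundedness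
  of the limit comes from \<open>bounded_limits\<close> and needs a common bound for the whole sequence.
\<close>

lemma skew_maps_limit:
  assumes h: "\<And>m. h m \<in> skew_maps T n" "uniformly_bounded T n (range h)"
    and lim: "\<And>xs. limitin T (\<lambda>m. h m xs) (f xs) sequentially"
  shows "f \<in> skew_maps T n"
proof -
  have "f xs = 0" if "length xs \<noteq> n" for xs
    using lim[of xs] h(1) that limit_const[of 0]
    by (auto simp: skew_maps_def multilinear_def intro: limit_unique)
  moreover have "linear (\<lambda>x. f (xs[i := x]))" if xs: "length xs = n" "i < n" for xs i
  proof (rule linearI)
    have lin: "linear (\<lambda>x. h m (xs[i := x]))" for m
      using h(1) xs by (simp add: skew_maps_def multilinear_def)
    show "f (xs[i := x + y]) = f (xs[i := x]) + f (xs[i := y])" for x y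
      using lim[of "xs[i := x + y]"] limit_add[OF lim[of "xs[i := x]"] lim[of "xs[i := y]"]]
      by (simp add: linear_add[OF lin] limit_unique)
    show "f (xs[i := c *\<^sub>R x]) = c *\<^sub>R f (xs[i := x])" for c x
      using lim[of "xs[i := c *\<^sub>R x]"] limit_scale[OF lim[of "xs[i := x]"], of c]
      by (simp add: linear_scale[OF lin] limit_unique)
  qed
  moreover have "f (permute_list \<sigma> xs) = of_int (sign \<sigma>) *\<^sub>R f xs"
    if "length xs = n" "\<sigma> permutes {..<n}" for xs \<sigma>
    using lim[of "permute_list \<sigma> xs"] limit_scale[OF lim[of xs], of "of_int (sign \<sigma>)"] h(1) that
    by (auto simp: skew_maps_def skew_symmetric_def intro: limit_unique)
  moreover have "uniformly_bounded T n {f}"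
    by (rule uniformly_bounded_subset[OF uniformly_bounded_limits[OF h(2)]]) (use lim in auto)
  ultimately show ?thesis
    by (simp add: skew_maps_def multilinear_def skew_symmetric_def)
qed

end

section \<open>Spaces of bounded skew symmetric maps\<close>

text \<open>
  Closure under pointwise limits is the form of closedness that Mackey completeness uses. It is
  required only of limits that are already known to be bounded skew symmetric maps.
\<close>

locale function_space = convenient_base T for T :: "'a::real_vector topology" +
  fixes n :: nat and V :: "('a list \<Rightarrow> 'a) set"
  assumes subspace_V: "subspace V"
    and V_skew: "V \<subseteq> skew_maps T n"
    and V_closed: "\<And>h f. (\<And>m. h m \<in> V) \<Longrightarrow> f \<in> skew_maps T n \<Longrightarrow>
      (\<And>xs. limitin T (\<lambda>m. h m xs) (f xs) sequentially) \<Longrightarrow> f \<in> V"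
begin

definition uniform_bornology where "uniform_bornology = {S. S \<subseteq> V \<and> uniformly_bounded T n S}"

sublocale F: bornology V uniform_bornology
  using subspace_V V_skew by unfold_locales (auto simp: uniform_bornology_def skew_maps_def)

text \<open>
  These discs detect uniform boundedness on a product of bounded sets, and with singletons for the
  bounded sets they separate points.
\<close>

lemma evaluation_disc:
  assumes Bs: "length Bs = n" "\<forall>B\<in>set Bs. vn_bounded T B" and W: "zero_disc W"
  shows "disc V uniform_bornology {f \<in> V. \<forall>xs\<in>listset Bs. f xs \<in> W}" (is "disc V uniform_bornology ?E")
proof -
  have ac: "absolutely_convex ?E"
    using zero_discD[OF W] subspace_V
    by (auto simp: absolutely_convex_def convex_def scaleR_fun_apply subspace_add subspace_scale)
  have "absorbs ?E S" if S: "S \<in> uniform_bornology" for S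
  proof -
    have "vn_bounded T {f xs | f xs. f \<in> S \<and> xs \<in> listset Bs}"
      using S Bs by (auto simp: uniform_bornology_def intro: uniformly_boundedD)
    then obtain e where "e > 0" "\<And>f xs. f \<in> S \<Longrightarrow> xs \<in> listset Bs \<Longrightarrow> e *\<^sub>R f xs \<in> W"
      using W unfolding bounded_disc by blast
    then show ?thesis
      unfolding absorbs_iff[OF ac] using S subspace_V
      by (intro exI[of _ e]) (auto simp: uniform_bornology_def scaleR_fun_apply subset_iff subspace_scale)
  qed
  with ac show ?thesis
    by (auto simp: disc_def)
qed

lemma vn_bounded_iff_uniformly_bounded:
  "vn_bounded (bornological_topology V uniform_bornology) S \<longleftrightarrow> S \<subseteq> V \<and> uniformly_bounded T n S"
proof
  assume "S \<subseteq> V \<and> uniformly_bounded T n S"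
  then show "vn_bounded (bornological_topology V uniform_bornology) S"
    by (intro F.members_bounded) (simp add: uniform_bornology_def)
next
  assume S: "vn_bounded (bornological_topology V uniform_bornology) S"
  have "uniformly_bounded T n S"
    unfolding uniformly_bounded_def bounded_disc
  proof (intro allI impI, elim conjE)
    fix Bs W assume "length Bs = n" "\<forall>B\<in>set Bs. \<forall>W. zero_disc W \<longrightarrow> (\<exists>e>0. \<forall>b\<in>B. e *\<^sub>R b \<in> W)"
      and W: "zero_disc W"
    then have "disc V uniform_bornology {f \<in> V. \<forall>xs\<in>listset Bs. f xs \<in> W}"
      by (intro evaluation_disc) (simp_all add: bounded_disc)
    then obtain e where "e > 0" "\<And>f. f \<in> S \<Longrightarrow> e *\<^sub>R f \<in> {f \<in> V. \<forall>xs\<in>listset Bs. f xs \<in> W}"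
      using S unfolding F.vn_bounded_iff by blast
    then show "\<exists>e>0. \<forall>b\<in>{f xs | f xs. f \<in> S \<and> xs \<in> listset Bs}. e *\<^sub>R b \<in> W"
      by (intro exI[of _ e]) (auto simp: scaleR_fun_apply)
  qed
  with S show "S \<subseteq> V \<and> uniformly_bounded T n S"
    by (simp add: F.vn_bounded_iff)
qed

lemma Hausdorff: "Hausdorff_space (bornological_topology V uniform_bornology)"
  unfolding F.Hausdorff_iff
proof (intro ballI impI)
  fix f assume f: "f \<in> V" "f \<noteq> 0"
  then obtain xs where xs: "f xs \<noteq> 0"
    by (auto simp: fun_eq_iff)
  then have "length xs = n"
    using f(1) V_skew by (auto simp: skew_maps_def multilinear_def)
  obtain W where W: "zero_disc W" "f xs \<notin> W"
    using B.Hausdorff_iff convenient xs by (auto simp: convenient_space_def zero_disc_def)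
  have "disc V uniform_bornology {g \<in> V. \<forall>ys\<in>listset (map (\<lambda>x. {x}) xs). g ys \<in> W}"
    using W(1) \<open>length xs = n\<close> bounded_singleton by (intro evaluation_disc) auto
  then show "\<exists>W. disc V uniform_bornology W \<and> f \<notin> W"
    using W(2) by (auto simp: listset_singletons)
qed

text \<open>
  A Mackey-Cauchy sequence \<open>x\<close> of maps is Mackey-Cauchy at each list of arguments, so it has a pointwise
  limit \<open>f\<close>. Up to a finite shift the sequence stays in \<open>x N + B\<close>, which makes \<open>f\<close> bounded. For the
  convergence, the quotients \<open>(x k - x m) / e\<close> lie in \<open>B\<close> for large \<open>k\<close> and \<open>m\<close>, so \<open>(x k - f) / e\<close> lies in the
  set \<open>D\<close> of pointwise limits of sequences in \<open>B\<close>. This set is uniformly bounded and hence absorbed by every disc \<open>W\<close>.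
  With \<open>e\<close> chosen such that \<open>e D \<subseteq> W\<close>, the differences \<open>x k - f\<close> lie in \<open>W\<close>.
\<close>

lemma mackey_complete: "mackey_complete (bornological_topology V uniform_bornology)"
  unfolding mackey_complete_def
proof (intro allI impI)
  fix x assume "mackey_cauchy (bornological_topology V uniform_bornology) x"
  then obtain B \<mu> where x: "\<And>m. x m \<in> V" and "vn_bounded (bornological_topology V uniform_bornology) B"
    and ac: "absolutely_convex B" and \<mu>: "(\<mu> \<longlongrightarrow> (0::real)) (sequentially \<times>\<^sub>F sequentially)"
    and diff: "\<And>m n. x m - x n \<in> (*\<^sub>R) (\<mu> (m, n)) ` B"
    unfolding mackey_cauchy_def F.topspace by blast
  then have B: "B \<subseteq> V" "uniformly_bounded T n B"
    unfolding vn_bounded_iff_uniformly_bounded by auto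
  have small: "\<exists>N. \<forall>m\<ge>N. \<forall>n\<ge>N. (1 / e) *\<^sub>R (x m - x n) \<in> B" if e: "e > 0" for e
  proof -
    have "\<forall>\<^sub>F p in sequentially \<times>\<^sub>F sequentially. \<bar>\<mu> p\<bar> < e"
      using tendstoD[OF \<mu> e] by simp
    then obtain N where N: "\<And>m n. m \<ge> N \<Longrightarrow> n \<ge> N \<Longrightarrow> \<bar>\<mu> (m, n)\<bar> < e"
      unfolding eventually_prod_sequentially by blast
    have "(1 / e) *\<^sub>R (x m - x n) \<in> B" if mn: "m \<ge> N" "n \<ge> N" for m n
    proof -
      obtain b where b: "b \<in> B" "x m - x n = \<mu> (m, n) *\<^sub>R b"
        using diff[of m n] by blast
      have "(\<mu> (m, n) / e) *\<^sub>R b \<in> B"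
        by (rule absolutely_convex_scale[OF ac]) (use N[OF mn] e b(1) in \<open>auto simp: field_simps\<close>)
      then show ?thesis
        using b(2) by simp
    qed
    then show ?thesis by blast
  qed
  have "\<exists>l. limitin T (\<lambda>m. x m xs) l sequentially" for xs
  proof -
    have ac': "absolutely_convex {f xs | f. f \<in> B}"
      unfolding absolutely_convex_def
    proof (intro conjI ballI allI impI)
      have "linear (\<lambda>f::'a list \<Rightarrow> 'a. f xs)"
        by (rule linearI) (auto simp: scaleR_fun_apply)
      then have "convex ((\<lambda>f. f xs) ` B)"
        using ac by (intro convex_linear_image) (auto simp: absolutely_convex_def)
      moreover have "(\<lambda>f. f xs) ` B = {f xs | f. f \<in> B}"
        by blast
      ultimately show "convex {f xs | f. f \<in> B}"
        by simp
      fix y c assume "y \<in> {f xs | f. f \<in> B}" "\<bar>c\<bar> \<le> (1::real)"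
      then obtain f where f: "f \<in> B" "y = f xs"
        by blast
      then have "c *\<^sub>R f \<in> B"
        using \<open>\<bar>c\<bar> \<le> 1\<close> absolutely_convex_scale[OF ac] by blast
      moreover have "c *\<^sub>R y = (c *\<^sub>R f) xs"
        using f(2) by (simp add: scaleR_fun_apply)
      ultimately show "c *\<^sub>R y \<in> {f xs | f. f \<in> B}"
        by blast
    qed
    moreover have "vn_bounded T {f xs | f. f \<in> B}"
      using B V_skew by (intro bounded_evaluation) auto
    moreover have "x m xs - x k xs \<in> (*\<^sub>R) (\<mu> (m, k)) ` {f xs | f. f \<in> B}" for m k
    proof -
      obtain b where b: "b \<in> B" "x m - x k = \<mu> (m, k) *\<^sub>R b"
        using diff[of m k] by blast
      then have "x m xs - x k xs = \<mu> (m, k) *\<^sub>R b xs"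
        by (metis minus_apply scaleR_fun_apply)
      with b(1) show ?thesis by blast
    qed
    ultimately have "mackey_cauchy T (\<lambda>m. x m xs)"
      unfolding mackey_cauchy_def topspace using \<mu> by blast
    then show ?thesis
      using convenient by (auto simp: convenient_space_def mackey_complete_def)
  qed
  then obtain f where lim: "\<And>xs. limitin T (\<lambda>m. x m xs) (f xs) sequentially"
    by metis
  have lim_shift: "limitin T (\<lambda>m. x (m + N) xs) (f xs) sequentially" for N xs
    using lim[of xs] limitin_subsequence[of "\<lambda>m. m + N" T "\<lambda>m. x m xs" "f xs"]
    by (simp add: o_def strict_mono_def)
  obtain N where N: "\<And>m. m \<ge> N \<Longrightarrow> x m - x N \<in> B"
    using small[of 1] by auto
  have "uniformly_bounded T n (range (\<lambda>m. x (m + N)))"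
  proof (rule uniformly_bounded_subset)
    show "uniformly_bounded T n {f + g | f g. f \<in> {x N} \<and> g \<in> B}"
      using x[of N] V_skew B by (intro uniformly_bounded_add) (auto simp: skew_maps_def)
    have "x (m + N) = x N + (x (m + N) - x N)" for m
      by simp
    then show "range (\<lambda>m. x (m + N)) \<subseteq> {f + g | f g. f \<in> {x N} \<and> g \<in> B}"
      using N[OF le_add2] by blast
  qed
  note ub = this
  have "x (m + N) \<in> skew_maps T n" for m
    using x V_skew by blast
  then have "f \<in> skew_maps T n"
    by (rule skew_maps_limit[OF _ ub lim_shift])
  then have f: "f \<in> V"
    using lim by (rule V_closed[OF x])
  have "\<forall>\<^sub>F k in sequentially. x k - f \<in> W" if W: "disc V uniform_bornology W" for W
  proof -
    let ?D = "{g. \<exists>h. range h \<subseteq> B \<and> (\<forall>xs. limitin T (\<lambda>m. h m xs) (g xs) sequentially)}"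
    have "?D \<inter> V \<in> uniform_bornology"
      using uniformly_bounded_subset[OF uniformly_bounded_limits[OF B(2)] Int_lower1]
      by (simp only: uniform_bornology_def mem_Collect_eq Int_lower2 simp_thms)
    with W have ac: "absolutely_convex W" and abs: "absorbs W (?D \<inter> V)"
      by (simp_all only: disc_def)
    from abs obtain e where e: "e > 0" "\<And>g. g \<in> ?D \<inter> V \<Longrightarrow> e *\<^sub>R g \<in> W"
      unfolding absorbs_iff[OF ac] by blast
    obtain N where N: "\<And>m k. m \<ge> N \<Longrightarrow> k \<ge> N \<Longrightarrow> (1 / e) *\<^sub>R (x m - x k) \<in> B"
      using small[OF e(1)] by blast
    have "x k - f \<in> W" if "k \<ge> N" for k
    proof -
      let ?h = "\<lambda>m. (1 / e) *\<^sub>R (x k - x (m + N))"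
      have "limitin T (\<lambda>m. ?h m xs) (((1 / e) *\<^sub>R (x k - f)) xs) sequentially" for xs
        using limit_scale[OF limit_add[OF limit_const limit_scale[OF lim_shift]],
            of "1 / e" "x k xs" "-1" N xs]
        by (simp add: scaleR_fun_apply)
      moreover have "range ?h \<subseteq> B"
        using N[OF that] by auto
      moreover have "(1 / e) *\<^sub>R (x k - f) \<in> V"
        using subspace_scale[OF subspace_V subspace_diff[OF subspace_V x f]] .
      ultimately have "(1 / e) *\<^sub>R (x k - f) \<in> ?D \<inter> V"
        by blast
      then have "e *\<^sub>R ((1 / e) *\<^sub>R (x k - f)) \<in> W"
        by (rule e(2))
      then show ?thesis
        using e(1) by simp
    qed
    then show ?thesis
      unfolding eventually_sequentially by blast
  qed
  with f have "limitin (bornological_topology V uniform_bornology) x f sequentially"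
    unfolding F.limitin_iff by simp
  then show "\<exists>l. limitin (bornological_topology V uniform_bornology) x l sequentially"
    by (intro exI[of _ f])
qed

lemma bornologification_eq:
  assumes "topspace X = V" "\<And>S. vn_bounded X S \<longleftrightarrow> S \<subseteq> V \<and> uniformly_bounded T n S"
  shows "bornologification X = bornological_topology V uniform_bornology"
  unfolding bornologification_def uniform_bornology_def assms ..

lemma convenient_function_space: "convenient_space (bornological_topology V uniform_bornology)"
  unfolding convenient_space_def
  by (intro conjI F.locally_convex Hausdorff mackey_complete
      bornologification_eq[OF F.topspace vn_bounded_iff_uniformly_bounded])

end

text \<open>
  Since \<open>S\<close> lies in the subspace \<open>P\<close> and \<open>P\<close> is stable under scaling, it is absorbed by \<open>U\<close> if and only if it is
  absorbed by the trace of \<open>U\<close> on \<open>P\<close>.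
\<close>

lemma vn_bounded_subtopology:
  assumes "subspace P" "P \<subseteq> topspace X"
  shows "vn_bounded (subtopology X P) S \<longleftrightarrow> S \<subseteq> P \<and> vn_bounded X S"
proof -
  have "absorbs (U \<inter> P) S" if U: "absorbs U S" and "S \<subseteq> P" for U
  proof -
    obtain r where r: "r > 0" "\<And>c. r \<le> \<bar>c\<bar> \<Longrightarrow> S \<subseteq> (*\<^sub>R) c ` U"
      using U unfolding absorbs_def by blast
    have "S \<subseteq> (*\<^sub>R) c ` (U \<inter> P)" if c: "r \<le> \<bar>c\<bar>" for c
    proof
      fix s assume s: "s \<in> S"
      with r(2)[OF c] have "s \<in> (*\<^sub>R) c ` U"
        by (rule subsetD)
      then obtain u where u: "u \<in> U" "s = c *\<^sub>R u"
        by (rule imageE) (rule that)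
      have "c \<noteq> 0"
        using c r(1) by auto
      then have "u = (1 / c) *\<^sub>R s"
        using u(2) by simp
      then have "u \<in> P"
        using s \<open>S \<subseteq> P\<close> subspace_scale[OF assms(1)] by blast
      with u show "s \<in> (*\<^sub>R) c ` (U \<inter> P)"
        by blast
    qed
    with r(1) show ?thesis
      unfolding absorbs_def by blast
  qed
  moreover have "absorbs U S" if "absorbs (U \<inter> P) S" for U
    using that unfolding absorbs_def by (meson Int_lower1 image_mono order_trans)
  ultimately have absorbs: "absorbs (U \<inter> P) S \<longleftrightarrow> absorbs U S" if "S \<subseteq> P" for U
    using that by blast
  have "(\<forall>U. openin (subtopology X P) U \<and> 0 \<in> U \<longrightarrow> absorbs U S) \<longleftrightarrow>
      (\<forall>U. openin X U \<and> 0 \<in> U \<longrightarrow> absorbs (U \<inter> P) S)"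
    using subspace_0[OF assms(1)] unfolding openin_subtopology by blast
  with absorbs assms(2) show ?thesis
    by (cases "S \<subseteq> P") (auto simp: vn_bounded_def)
qed

section \<open>Insertion by recursion over the arguments\<close>

abbreviation sg :: "int \<Rightarrow> real" where
  "sg k \<equiv> (- 1) powi k"

lemma sg_square [simp]: "sg k * sg k = 1"
  by simp

lemma sg_pred [simp]: "sg (k - 1) = - sg k"
  by (simp add: power_int_diff)

lemma sg_add: "sg (k + l) = sg k * sg l"
  by (simp add: power_int_add)

lemma sg_mult_pred_left: "sg ((k - 1) * l) = sg (k * l) * sg l"
proof -
  have "(k - 1) * l = k * l + - l"
    by (simp add: left_diff_distrib)
  then show ?thesis
    by (simp only: sg_add power_int_minus_one_minus)
qed

lemma sg_mult_pred_right: "sg (k * (l - 1)) = sg (k * l) * sg k"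
proof -
  have "k * (l - 1) = k * l + - k"
    by (simp add: right_diff_distrib)
  then show ?thesis
    by (simp only: sg_add power_int_minus_one_minus)
qed

definition contract :: "'a \<Rightarrow> ('a list \<Rightarrow> 'b) \<Rightarrow> 'a list \<Rightarrow> 'b" where
  "contract v f = (\<lambda>xs. f (v # xs))"

lemma contract_apply: "contract v f xs = f (v # xs)"
  by (simp add: contract_def)

lemma contract_add [simp]: "contract v (f + g) = contract v f + contract v g"
  by (simp add: fun_eq_iff contract_apply)

lemma contract_uminus [simp]: "contract v (- f) = - contract v f"
  by (simp add: fun_eq_iff contract_apply)

lemma contract_scale [simp]: "contract v (c *\<^sub>R f) = c *\<^sub>R contract v f"
  by (simp add: fun_eq_iff contract_apply scaleR_fun_apply)

text \<open>
  The insertion \<open>i\<^sub>K \<Phi>\<close> for \<open>K\<close> of degree \<open>k\<close>, that is, with \<open>k + 1\<close> arguments: the first argument \<open>v\<close> goes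
  either into \<open>K\<close>, or past \<open>K\<close> into \<open>\<Phi>\<close>. In the second case it passes the \<open>k + 1\<close> arguments of \<open>K\<close> and the slot
  that \<open>K\<close> occupies in \<open>\<Phi>\<close>, whence the sign \<open>(- 1)\<^sup>k\<close>. The degree is an integer, so contraction lowers it
  without a case distinction, and the arity of \<open>\<Phi>\<close> does not enter.
\<close>

fun ins :: "int \<Rightarrow> ('a::real_vector list \<Rightarrow> 'a) \<Rightarrow> ('a list \<Rightarrow> 'a) \<Rightarrow> 'a list \<Rightarrow> 'a" where
  "ins k K \<Phi> [] = \<Phi> [K []]"
| "ins k K \<Phi> (v # vs) = ins (k - 1) (contract v K) \<Phi> vs + sg k *\<^sub>R ins k K (contract v \<Phi>) vs"

lemma contract_ins:
  "contract v (ins k K \<Phi>) = ins (k - 1) (contract v K) \<Phi> + sg k *\<^sub>R ins k K (contract v \<Phi>)"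
  by (simp add: fun_eq_iff contract_apply scaleR_fun_apply)

lemma ins_add_right: "ins k K (\<Phi> + \<Psi>) = ins k K \<Phi> + ins k K \<Psi>"
proof -
  have "ins k K (\<Phi> + \<Psi>) vs = ins k K \<Phi> vs + ins k K \<Psi> vs" for vs
    by (induction vs arbitrary: k K \<Phi> \<Psi>) (simp_all add: scaleR_add_right)
  then show ?thesis
    by (simp add: fun_eq_iff)
qed

lemma ins_linear_right:
  assumes "linear h"
  shows "ins k K (\<lambda>xs. h (\<Phi> xs)) vs = h (ins k K \<Phi> vs)"
proof (induction vs arbitrary: k K \<Phi>)
  case (Cons v vs)
  have "contract v (\<lambda>xs. h (\<Phi> xs)) = (\<lambda>xs. h (contract v \<Phi> xs))"
    by (simp add: fun_eq_iff contract_apply)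
  then show ?case
    by (simp add: Cons linear_add[OF assms] linear_scale[OF assms])
qed simp

lemma ins_scale_right: "ins k K (c *\<^sub>R \<Phi>) = c *\<^sub>R ins k K \<Phi>"
  using ins_linear_right[OF linear_scaleR, of k K c \<Phi>] by (simp add: fun_eq_iff scaleR_fun_def)

lemma ins_zero_right [simp]: "ins k K 0 = 0"
  using ins_scale_right[of k K 0 0] by simp

lemma ins_uminus_right: "ins k K (- \<Phi>) = - ins k K \<Phi>"
  using ins_scale_right[of k K "- 1" \<Phi>] by simp

lemma ins_diff_right: "ins k K (\<Phi> - \<Psi>) = ins k K \<Phi> - ins k K \<Psi>"
  using ins_add_right[of k K \<Phi> "- \<Psi>"] by (simp add: ins_uminus_right)

text \<open>
  These three conditions make sense for functions on lists of all lengths and, up to the shift of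
  the degree, are inherited by contractions. This makes them suitable for induction over the arguments.
\<close>

definition slotwise_linear :: "('a::real_vector list \<Rightarrow> 'a) \<Rightarrow> bool" where
  "slotwise_linear f \<longleftrightarrow> (\<forall>us ws. linear (\<lambda>x. f (us @ x # ws)))"

definition alternating :: "('a::real_vector list \<Rightarrow> 'a) \<Rightarrow> bool" where
  "alternating f \<longleftrightarrow> (\<forall>us x y ws. f (us @ x # y # ws) = - f (us @ y # x # ws))"

definition homogeneous :: "int \<Rightarrow> ('a::real_vector list \<Rightarrow> 'a) \<Rightarrow> bool" where
  "homogeneous k f \<longleftrightarrow> (\<forall>xs. int (length xs) \<noteq> k + 1 \<longrightarrow> f xs = 0)"

lemma slotwise_linear_first: "slotwise_linear f \<Longrightarrow> linear (\<lambda>x. f (x # ws))"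
  unfolding slotwise_linear_def by (drule spec[of _ "[]"]) simp

lemma slotwise_linear_contract: "slotwise_linear f \<Longrightarrow> slotwise_linear (contract v f)"
  unfolding slotwise_linear_def contract_def by (intro allI, erule_tac x = "v # us" in allE) simp

lemma slotwise_linear_contract_linear:
  assumes "slotwise_linear f"
  shows "contract (x + y) f = contract x f + contract y f" "contract (c *\<^sub>R x) f = c *\<^sub>R contract x f"
  using linear_add[OF slotwise_linear_first[OF assms]] linear_scale[OF slotwise_linear_first[OF assms]]
  by (simp_all add: fun_eq_iff contract_apply scaleR_fun_apply)

lemma alternatingD: "alternating f \<Longrightarrow> f (us @ x # y # ws) = - f (us @ y # x # ws)"
  unfolding alternating_def by blast

lemma alternating_contract:
  assumes "alternating f"
  shows "alternating (contract v f)"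
  unfolding alternating_def contract_def
proof (intro allI)
  show "f (v # us @ x # y # ws) = - f (v # us @ y # x # ws)" for us x y ws
    using alternatingD[OF assms, of "v # us" x y ws] by (simp only: append_Cons)
qed

lemma alternating_swap:
  assumes "alternating f"
  shows "contract y (contract x f) = - contract x (contract y f)"
  using alternatingD[OF assms, of "[]" x y] by (simp only: fun_eq_iff contract_apply append_Nil uminus_apply simp_thms)

lemma homogeneous_contract: "homogeneous k f \<Longrightarrow> homogeneous (k - 1) (contract v f)"
  by (simp add: homogeneous_def contract_apply)

lemma homogeneous_Nil: "homogeneous k f \<Longrightarrow> f [] = 0 \<or> k = - 1"
  unfolding homogeneous_def by fastforce

text \<open>
  Additivity in the inserted map, unlike the one in \<open>\<Phi>\<close>, uses linearity of \<open>\<Phi>\<close> in its first slot.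
\<close>

lemma ins_add_left:
  assumes "slotwise_linear \<Phi>"
  shows "ins k (K + L) \<Phi> = ins k K \<Phi> + ins k L \<Phi>"
proof -
  have "ins k (K + L) \<Phi> vs = ins k K \<Phi> vs + ins k L \<Phi> vs" for vs
    using assms
  proof (induction vs arbitrary: k K L \<Phi>)
    case Nil
    then show ?case
      using linear_add[OF slotwise_linear_first] by simp
  next
    case (Cons v vs)
    then show ?case
      by (simp add: slotwise_linear_contract scaleR_add_right del: plus_fun_apply)
  qed
  then show ?thesis
    by (simp add: fun_eq_iff)
qed

lemma ins_scale_left:
  assumes "slotwise_linear \<Phi>"
  shows "ins k (c *\<^sub>R K) \<Phi> = c *\<^sub>R ins k K \<Phi>"
proof -
  have "ins k (c *\<^sub>R K) \<Phi> vs = c *\<^sub>R ins k K \<Phi> vs" for vs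
    using assms
  proof (induction vs arbitrary: k K \<Phi>)
    case Nil
    then show ?case
      using linear_scale[OF slotwise_linear_first] by (simp add: scaleR_fun_apply)
  next
    case (Cons v vs)
    then show ?case
      by (simp add: slotwise_linear_contract scaleR_add_right scaleR_left_commute)
  qed
  then show ?thesis
    by (simp add: fun_eq_iff scaleR_fun_apply)
qed

lemma ins_zero_left: "slotwise_linear \<Phi> \<Longrightarrow> ins k 0 \<Phi> = 0"
  using ins_scale_left[of \<Phi> k 0 0] by simp

lemma ins_uminus_left: "slotwise_linear \<Phi> \<Longrightarrow> ins k (- K) \<Phi> = - ins k K \<Phi>"
  using ins_scale_left[of \<Phi> k "- 1" K] by simp

lemma ins_diff_left: "slotwise_linear \<Phi> \<Longrightarrow> ins k (K - L) \<Phi> = ins k K \<Phi> - ins k L \<Phi>"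
  using ins_add_left[of \<Phi> k K "- L"] by (simp add: ins_uminus_left)

lemma slotwise_linear_ins:
  assumes "slotwise_linear K" "slotwise_linear \<Phi>"
  shows "slotwise_linear (ins k K \<Phi>)"
proof -
  have "linear (\<lambda>x. ins k K \<Phi> (us @ x # ws))" for us ws
    using assms
  proof (induction us arbitrary: k K \<Phi>)
    case Nil
    show ?case
      by (rule linearI)
        (simp_all add: Nil slotwise_linear_contract_linear ins_add_left ins_add_right ins_scale_left
          ins_scale_right scaleR_add_right scaleR_fun_apply scaleR_left_commute)
  next
    case (Cons v vs)
    then show ?case
      by (simp add: slotwise_linear_contract linear_compose_add linear_compose_scale_right)
  qed
  then show ?thesis
    by (simp add: slotwise_linear_def)
qed

lemma homogeneous_ins:
  assumes "homogeneous k K" "homogeneous l \<Phi>" "slotwise_linear \<Phi>"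
  shows "homogeneous (k + l) (ins k K \<Phi>)"
proof -
  have "ins k K \<Phi> vs = 0" if "int (length vs) \<noteq> k + l + 1" for vs
    using assms that
  proof (induction vs arbitrary: k l K \<Phi>)
    case Nil
    show ?case
    proof (cases "l = 0")
      case True
      then have "K [] = 0"
        using Nil by (auto dest: homogeneous_Nil)
      then show ?thesis
        using linear_0[OF slotwise_linear_first[OF Nil(3), of "[]"]] by simp
    next
      case False
      then show ?thesis
        using Nil(2) by (simp add: homogeneous_def)
    qed
  next
    case (Cons v vs)
    have "ins (k - 1) (contract v K) \<Phi> vs = 0"
      by (rule Cons.IH[OF homogeneous_contract Cons.prems(2,3)]) (use Cons.prems in auto)
    moreover have "ins k K (contract v \<Phi>) vs = 0"
      by (rule Cons.IH[OF Cons.prems(1) homogeneous_contract slotwise_linear_contract])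
        (use Cons.prems in auto)
    ultimately show ?case
      by simp
  qed
  then show ?thesis
    by (simp add: homogeneous_def)
qed

text \<open>
  Contracting the associator of \<open>K\<close>, \<open>L\<close>, \<open>M\<close> with \<open>v\<close> gives the associators in which one of the three maps
  is contracted, with the signs \<open>1\<close>, \<open>(- 1)\<^sup>k\<close>, \<open>(- 1)\<^sup>k\<^sup>+\<^sup>l\<close>. Exchanging \<open>K\<close> and \<open>L\<close> permutes these terms, and the
  induction hypotheses provide the right signs. On the empty list the associator is
  \<open>(- 1)\<^sup>l M (K, L)\<close> for constants \<open>K\<close> and \<open>L\<close> (degree \<open>- 1\<close>), and skew symmetry of \<open>M\<close> applies.
\<close>

theorem ins_pre_Lie:
  assumes "homogeneous k K" "homogeneous l L" "slotwise_linear M" "alternating M"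
  shows "ins k K (ins l L M) - ins (k + l) (ins k K L) M =
    sg (k * l) *\<^sub>R (ins l L (ins k K M) - ins (k + l) (ins l L K) M)"
proof -
  have "ins k K (ins l L M) vs - ins (k + l) (ins k K L) M vs =
    sg (k * l) *\<^sub>R (ins l L (ins k K M) vs - ins (k + l) (ins l L K) M vs)" for vs
    using assms
  proof (induction vs arbitrary: k l K L M)
    case Nil
    note zero = linear_0[OF slotwise_linear_first[OF Nil(3)]]
      linear_0[OF slotwise_linear_first[OF slotwise_linear_contract[OF Nil(3)], unfolded contract_apply]]
    have swap: "M [L [], K []] = - M [K [], L []]"
      using alternatingD[OF Nil(4), of "[]" "L []" "K []" "[]"] by (simp only: append_Nil)
    show ?case
    proof (cases "K [] = 0 \<or> L [] = 0")
      case True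
      then show ?thesis
        by (auto simp: zero contract_apply)
    next
      case False
      then have "k = - 1" "l = - 1"
        using Nil(1,2) by (auto dest: homogeneous_Nil)
      then show ?thesis
        by (simp add: swap contract_apply)
    qed
  next
    case (Cons v vs)
    have sl: "slotwise_linear (contract v M)" and al: "alternating (contract v M)"
      using Cons.prems by (simp_all add: slotwise_linear_contract alternating_contract)
    have K: "homogeneous (k - 1) (contract v K)" and L: "homogeneous (l - 1) (contract v L)"
      using Cons.prems by (simp_all add: homogeneous_contract)
    note IH1 = Cons.IH[OF K Cons.prems(2-4)]
    note IH2 = Cons.IH[OF Cons.prems(1) L Cons.prems(3,4)]
    note IH3 = Cons.IH[OF Cons.prems(1,2) sl al]
    have D: "ins p P (ins q Q M) (v # vs) - ins (p + q) (ins p P Q) M (v # vs) =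
      (ins (p - 1) (contract v P) (ins q Q M) vs - ins (p - 1 + q) (ins (p - 1) (contract v P) Q) M vs)
      + sg p *\<^sub>R (ins p P (ins (q - 1) (contract v Q) M) vs - ins (p + (q - 1)) (ins p P (contract v Q)) M vs)
      + (sg p * sg q) *\<^sub>R (ins p P (ins q Q (contract v M)) vs - ins (p + q) (ins p P Q) (contract v M) vs)"
      for p q P Q
    proof -
      have "ins p P (ins q Q M) (v # vs) = ins (p - 1) (contract v P) (ins q Q M) vs
        + sg p *\<^sub>R ins p P (ins (q - 1) (contract v Q) M) vs
        + (sg p * sg q) *\<^sub>R ins p P (ins q Q (contract v M)) vs"
        by (simp add: contract_ins ins_add_right ins_scale_right scaleR_fun_apply scaleR_add_right)
      moreover have "ins (p + q) (ins p P Q) M (v # vs) = ins (p + q - 1) (ins (p - 1) (contract v P) Q) M vs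
        + sg p *\<^sub>R ins (p + q - 1) (ins p P (contract v Q)) M vs
        + (sg p * sg q) *\<^sub>R ins (p + q) (ins p P Q) (contract v M) vs"
        by (simp add: contract_ins ins_add_left[OF Cons.prems(3)] ins_scale_left[OF Cons.prems(3)]
            sg_add scaleR_fun_apply)
      moreover have "p - 1 + q = p + q - 1" "p + (q - 1) = p + q - 1"
        by simp_all
      ultimately show ?thesis
        by (simp only: scaleR_diff_right add_diff_add)
    qed
    have collect: "(s * f) *\<^sub>R A + e *\<^sub>R ((s * e) *\<^sub>R B) + (e * f) *\<^sub>R (s *\<^sub>R C) =
      s *\<^sub>R (B + f *\<^sub>R A + (f * e) *\<^sub>R C)" if "e * e = 1" for s e f :: real and A B C :: 'a
    proof -
      have "e * (s * e) = s"
        using that by (simp add: mult.left_commute)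
      then show ?thesis
        by (simp add: scaleR_add_right ac_simps)
    qed
    have "ins l L (ins k K M) (v # vs) - ins (k + l) (ins l L K) M (v # vs) =
      (ins (l - 1) (contract v L) (ins k K M) vs - ins (k + (l - 1)) (ins (l - 1) (contract v L) K) M vs)
      + sg l *\<^sub>R (ins l L (ins (k - 1) (contract v K) M) vs - ins (k - 1 + l) (ins l L (contract v K)) M vs)
      + (sg l * sg k) *\<^sub>R (ins l L (ins k K (contract v M)) vs - ins (k + l) (ins l L K) (contract v M) vs)"
      using D[of l L k K] by (simp only: add.commute)
    then show ?case
      unfolding D[of k K l L] IH1 IH2 IH3 sg_mult_pred_left sg_mult_pred_right
      by (simp only: collect[OF sg_square])
  qed
  then show ?thesis
    by (simp add: fun_eq_iff scaleR_fun_apply)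
qed

section \<open>Insertion as an alternating sum over permutations\<close>

(* From here on, transpose is the transposition of two indices, not of a matrix. *)
hide_const (open) Finite_Cartesian_Product.transpose

definition skew_form :: "nat \<Rightarrow> ('a::real_vector list \<Rightarrow> 'a) \<Rightarrow> bool" where
  "skew_form n f \<longleftrightarrow> multilinear n f \<and> skew_symmetric n f"

lemma skew_form_length: "skew_form n f \<Longrightarrow> length xs \<noteq> n \<Longrightarrow> f xs = 0"
  by (simp add: skew_form_def multilinear_def)

lemma skew_form_permute:
  "skew_form n f \<Longrightarrow> length xs = n \<Longrightarrow> \<sigma> permutes {..<n} \<Longrightarrow>
    f (permute_list \<sigma> xs) = of_int (sign \<sigma>) *\<^sub>R f xs"
  unfolding skew_form_def skew_symmetric_def by blast

lemma skew_form_homogeneous: "skew_form n f \<Longrightarrow> homogeneous (int n - 1) f"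
  by (simp add: skew_form_def multilinear_def homogeneous_def)

lemma skew_form_slotwise_linear:
  assumes "skew_form n f"
  shows "slotwise_linear f"
  unfolding slotwise_linear_def
proof (intro allI)
  fix us ws
  show "linear (\<lambda>x. f (us @ x # ws))"
  proof (cases "length us + 1 + length ws = n")
    case True
    have "linear (\<lambda>x. f (xs[i := x]))" if "length xs = n" "i < n" for xs i
      using assms that by (simp add: skew_form_def multilinear_def)
    from this[of "us @ 0 # ws" "length us"] True show ?thesis
      by simp
  next
    case False
    then have "f (us @ x # ws) = 0" for x
      using skew_form_length[OF assms] by simp
    then show ?thesis
      by (simp add: linear_zero)
  qed
qed

lemma multilinearI:
  assumes "slotwise_linear f" "\<And>xs. length xs \<noteq> n \<Longrightarrow> f xs = 0"
  shows "multilinear n f"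
  using assms by (simp add: multilinear_def slotwise_linear_def upd_conv_take_nth_drop)

lemma permute_list_transpose:
  "permute_list (transpose (length A) (Suc (length A + length B))) (A @ x # B @ y # C) = A @ y # B @ x # C"
proof (rule nth_equalityI)
  fix i assume "i < length (permute_list (transpose (length A) (Suc (length A + length B))) (A @ x # B @ y # C))"
  moreover have "transpose (length A) (Suc (length A + length B)) permutes {..<length (A @ x # B @ y # C)}"
    by (rule permutes_swap_id) auto
  ultimately have *: "permute_list (transpose (length A) (Suc (length A + length B))) (A @ x # B @ y # C) ! i
      = (A @ x # B @ y # C) ! transpose (length A) (Suc (length A + length B)) i"
    by (intro permute_list_nth) simp_all
  consider "i = length A" | "i = Suc (length A + length B)" | "i \<noteq> length A" "i \<noteq> Suc (length A + length B)"
    by blast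
  then show "permute_list (transpose (length A) (Suc (length A + length B))) (A @ x # B @ y # C) ! i
      = (A @ y # B @ x # C) ! i"
  proof cases
    case 1
    then show ?thesis
      unfolding * by (simp add: nth_append)
  next
    case 2
    then show ?thesis
      unfolding * by (simp add: nth_append)
  next
    case 3
    then show ?thesis
      unfolding * by (auto simp: transpose_apply_other nth_append nth_Cons')
  qed
qed simp

lemma permute_list_snoc:
  assumes "\<sigma> permutes {..<length xs}"
  shows "permute_list \<sigma> (xs @ [v]) = permute_list \<sigma> xs @ [v]"
proof -
  have "\<sigma> (length xs) = length xs"
    using assms by (simp add: permutes_def)
  moreover have "\<sigma> i < length xs" if "i < length xs" for i
    using permutes_in_image[OF assms, of i] that by simp
  ultimately show ?thesis
    by (simp add: permute_list_def nth_append)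
qed

lemma skew_symmetric_imp_alternating:
  assumes "\<And>xs. length xs \<noteq> n \<Longrightarrow> f xs = 0" "skew_symmetric n f"
  shows "alternating f"
  unfolding alternating_def
proof (intro allI)
  fix us ws x y
  show "f (us @ x # y # ws) = - f (us @ y # x # ws)"
  proof (cases "length us + 2 + length ws = n")
    case True
    let ?\<tau> = "transpose (length us) (Suc (length us))"
    have "f (permute_list ?\<tau> (us @ y # x # ws)) = of_int (sign ?\<tau>) *\<^sub>R f (us @ y # x # ws)"
    proof -
      have "?\<tau> permutes {..<n}"
        by (rule permutes_swap_id) (use True in auto)
      then show ?thesis
        using assms(2) True unfolding skew_symmetric_def by simp
    qed
    then show ?thesis
      using permute_list_transpose[of us "[]" y x ws] by (simp add: sign_swap_id)
  next
    case False
    then show ?thesis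
      using assms(1) by simp
  qed
qed

lemma skew_form_alternating:
  assumes "skew_form n f"
  shows "alternating f"
  by (rule skew_symmetric_imp_alternating[of n]) (use assms in \<open>auto simp: skew_form_def multilinear_def\<close>)

lemma alternating_move:
  assumes "alternating f"
  shows "f (us @ C @ [x]) = (- 1) ^ length C *\<^sub>R f (us @ x # C)"
proof (induction C arbitrary: us)
  case (Cons c C)
  have "f (us @ (c # C) @ [x]) = (- 1) ^ length C *\<^sub>R f ((us @ [c]) @ x # C)"
    using Cons[of "us @ [c]"] by simp
  also have "f ((us @ [c]) @ x # C) = - f (us @ x # c # C)"
    using alternatingD[OF assms, of us c x C] by simp
  finally show ?case
    by simp
qed simp

text \<open>
  A permutation of the first \<open>n\<close> indices fixes the index \<open>n\<close>, so an argument appended at the end is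
  unaffected by it. Hence the permutation sums are expanded at the last argument, and skew symmetry
  carries the result over to the first one.
\<close>

definition rcontract :: "'a \<Rightarrow> ('a list \<Rightarrow> 'b) \<Rightarrow> 'a list \<Rightarrow> 'b" where
  "rcontract v f = (\<lambda>xs. f (xs @ [v]))"

lemma contract_eq_rcontract:
  assumes "skew_form (Suc n) f"
  shows "contract v f = (- 1) ^ n *\<^sub>R rcontract v f"
proof
  fix xs
  show "contract v f xs = ((- 1) ^ n *\<^sub>R rcontract v f) xs"
  proof (cases "length xs = n")
    case True
    then show ?thesis
      using alternating_move[OF skew_form_alternating[OF assms], of "[]" xs v]
      by (simp add: contract_apply rcontract_def scaleR_fun_apply flip: power_mult_distrib)
  next
    case False
    then show ?thesis
      using skew_form_length[OF assms] by (simp add: contract_apply rcontract_def scaleR_fun_apply)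
  qed
qed

lemma skew_form_scale: "skew_form n f \<Longrightarrow> skew_form n (c *\<^sub>R f)"
  by (auto simp: skew_form_def multilinear_def skew_symmetric_def scaleR_fun_apply scaleR_left_commute
      intro: linear_compose_scale_right)

lemma skew_form_contract:
  assumes "skew_form (Suc n) f"
  shows "skew_form n (contract v f)"
proof -
  have "slotwise_linear (rcontract v f)"
    using skew_form_slotwise_linear[OF assms] by (simp add: slotwise_linear_def rcontract_def)
  moreover have "rcontract v f xs = 0" if "length xs \<noteq> n" for xs
    using skew_form_length[OF assms] that by (simp add: rcontract_def)
  moreover have "rcontract v f (permute_list \<sigma> xs) = of_int (sign \<sigma>) *\<^sub>R rcontract v f xs"
    if "length xs = n" "\<sigma> permutes {..<n}" for xs \<sigma>
  proof -
    have "\<sigma> permutes {..<Suc n}"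
      using that(2) by (rule permutes_subset) auto
    then have "f (permute_list \<sigma> (xs @ [v])) = of_int (sign \<sigma>) *\<^sub>R f (xs @ [v])"
      using that(1) by (intro skew_form_permute[OF assms]) auto
    then show ?thesis
      using that permute_list_snoc[of \<sigma> xs v] by (simp add: rcontract_def)
  qed
  ultimately have "skew_form n (rcontract v f)"
    by (auto simp: skew_form_def skew_symmetric_def intro: multilinearI)
  then show ?thesis
    unfolding contract_eq_rcontract[OF assms] by (rule skew_form_scale)
qed

definition alternation :: "nat \<Rightarrow> ('a list \<Rightarrow> 'b::real_vector) \<Rightarrow> 'a list \<Rightarrow> 'b" where
  "alternation n F vs = (\<Sum>\<sigma> | \<sigma> permutes {..<n}. of_int (sign \<sigma>) *\<^sub>R F (permute_list \<sigma> vs))"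

lemma permutation_lessThan: "\<sigma> permutes {..<n::nat} \<Longrightarrow> permutation \<sigma>"
  by (rule permutes_imp_permutation[OF finite_lessThan])

lemma alternation_permute:
  assumes "\<tau> permutes {..<n}" "length vs = n"
  shows "alternation n F (permute_list \<tau> vs) = of_int (sign \<tau>) *\<^sub>R alternation n F vs"
proof -
  let ?g = "\<lambda>\<sigma>. of_int (sign \<sigma>) *\<^sub>R F (permute_list \<sigma> vs)"
  have "of_int (sign \<sigma>) *\<^sub>R F (permute_list \<sigma> (permute_list \<tau> vs)) = of_int (sign \<tau>) *\<^sub>R ?g (\<tau> \<circ> \<sigma>)"
    if "\<sigma> permutes {..<n}" for \<sigma>
  proof -
    have "permute_list (\<tau> \<circ> \<sigma>) vs = permute_list \<sigma> (permute_list \<tau> vs)"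
      using that assms(2) by (intro permute_list_compose) simp
    moreover have "sign (\<tau> \<circ> \<sigma>) = sign \<tau> * sign \<sigma>"
      using that assms(1) by (intro sign_compose permutation_lessThan)
    moreover have "of_int (sign \<tau>) * (of_int (sign \<tau>) * of_int (sign \<sigma>)) = (of_int (sign \<sigma>) :: real)"
      by (simp flip: of_int_mult mult.assoc)
    ultimately show ?thesis
      by simp
  qed
  then have "alternation n F (permute_list \<tau> vs) = (\<Sum>\<sigma> | \<sigma> permutes {..<n}. of_int (sign \<tau>) *\<^sub>R ?g (\<tau> \<circ> \<sigma>))"
    unfolding alternation_def by (intro sum.cong) auto
  also have "\<dots> = of_int (sign \<tau>) *\<^sub>R (\<Sum>\<sigma> | \<sigma> permutes {..<n}. ?g (\<tau> \<circ> \<sigma>))"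
    by (rule scaleR_sum_right[symmetric])
  also have "(\<Sum>\<sigma> | \<sigma> permutes {..<n}. ?g (\<tau> \<circ> \<sigma>)) = alternation n F vs"
    unfolding alternation_def by (rule setum_permutations_compose_left[OF assms(1), symmetric])
  finally show ?thesis .
qed

text \<open>
  Every permutation of \<open>Suc n\<close> indices is \<open>q \<circ> transpose n b\<close> for a unique \<open>b\<close> and a unique \<open>q\<close> which fixes
  \<open>n\<close>. The index \<open>b\<close> is the place to which \<open>v\<close> is moved. If \<open>F\<close> is skew symmetric separately in its first \<open>m\<close>
  slots and in the remaining ones, then the place matters only up to its block: all \<open>b \<ge> m\<close> give the
  contribution of \<open>b = n\<close>, and all \<open>b < m\<close> that of \<open>b = m - 1\<close>.
\<close>

lemma alternation_snoc:
  fixes F :: "'a list \<Rightarrow> 'b::real_vector"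
  assumes len: "length vs = n" "m \<le> Suc n"
    and first_block: "\<And>i j ws. length ws = Suc n \<Longrightarrow> i < m \<Longrightarrow> j < m \<Longrightarrow>
      of_int (sign (transpose i j)) *\<^sub>R F (permute_list (transpose i j) ws) = F ws"
    and last_block: "\<And>i j ws. length ws = Suc n \<Longrightarrow> m \<le> i \<Longrightarrow> i \<le> n \<Longrightarrow> m \<le> j \<Longrightarrow> j \<le> n \<Longrightarrow>
      of_int (sign (transpose i j)) *\<^sub>R F (permute_list (transpose i j) ws) = F ws"
  shows "alternation (Suc n) F (vs @ [v]) =
    real (Suc n - m) *\<^sub>R alternation n (\<lambda>us. F (us @ [v])) vs +
    real m *\<^sub>R alternation n (\<lambda>us. of_int (sign (transpose n (m - 1))) *\<^sub>R
      F (permute_list (transpose n (m - 1)) (us @ [v]))) vs"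
proof -
  let ?P = "{q. q permutes {..<n}}"
  define t where "t \<sigma> = of_int (sign \<sigma>) *\<^sub>R F (permute_list \<sigma> (vs @ [v]))" for \<sigma>
  define T where "T b = (\<Sum>q\<in>?P. t (q \<circ> transpose n b))" for b
  have compose: "t (\<sigma> \<circ> transpose i j) = of_int (sign \<sigma>) *\<^sub>R of_int (sign (transpose i j)) *\<^sub>R
      F (permute_list (transpose i j) (permute_list \<sigma> (vs @ [v])))"
    if "\<sigma> permutes {..<Suc n}" "i \<le> n" "j \<le> n" for \<sigma> i j
  proof -
    have "transpose i j permutes {..<Suc n}"
      using that by (intro permutes_swap_id) auto
    then have "sign (\<sigma> \<circ> transpose i j) = sign \<sigma> * sign (transpose i j)"
      and "permute_list (\<sigma> \<circ> transpose i j) (vs @ [v]) = permute_list (transpose i j) (permute_list \<sigma> (vs @ [v]))"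
      using that(1) len(1) by (intro sign_compose permutation_lessThan permute_list_compose; simp)+
    then show ?thesis
      by (simp add: t_def)
  qed
  have extend: "q permutes {..<Suc n}" if "q \<in> ?P" for q
    using that by (auto intro: permutes_subset)
  have "alternation (Suc n) F (vs @ [v]) = sum t {\<sigma>. \<sigma> permutes insert n {..<n}}"
    by (simp add: alternation_def t_def lessThan_Suc)
  also have "\<dots> = (\<Sum>\<sigma> | \<sigma> permutes insert n {..<n}. t (inv \<sigma>))"
    by (rule sum_permutations_inverse)
  also have "\<dots> = (\<Sum>b\<in>insert n {..<n}. \<Sum>q\<in>?P. t (inv (transpose n b \<circ> q)))"
    by (rule sum_over_permutations_insert) auto
  also have "\<dots> = (\<Sum>b\<in>insert n {..<n}. T b)"
  proof (rule sum.cong[OF refl])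
    fix b
    have "(\<Sum>q\<in>?P. t (inv (transpose n b \<circ> q))) = (\<Sum>q\<in>?P. t (inv q \<circ> transpose n b))"
    proof (rule sum.cong[OF refl])
      fix q assume "q \<in> ?P"
      then have "inv (transpose n b \<circ> q) = inv q \<circ> transpose n b"
        by (simp add: o_inv_distrib permutes_bij)
      then show "t (inv (transpose n b \<circ> q)) = t (inv q \<circ> transpose n b)"
        by simp
    qed
    also have "\<dots> = T b"
      unfolding T_def by (rule sum_permutations_inverse[symmetric])
    finally show "(\<Sum>q\<in>?P. t (inv (transpose n b \<circ> q))) = T b" .
  qed
  also have "\<dots> = (\<Sum>b\<in>{m..<Suc n}. T b) + (\<Sum>b\<in>{..<m}. T b)"
  proof -
    have "insert n {..<n} = {m..<Suc n} \<union> {..<m}"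
      using len(2) by auto
    then show ?thesis
      by (simp only:) (rule sum.union_disjoint; auto)
  qed
  also have "(\<Sum>b\<in>{m..<Suc n}. T b) = (\<Sum>b\<in>{m..<Suc n}. alternation n (\<lambda>us. F (us @ [v])) vs)"
  proof (rule sum.cong[OF refl])
    fix b assume b: "b \<in> {m..<Suc n}"
    have "t (q \<circ> transpose n b) = of_int (sign q) *\<^sub>R F (permute_list q vs @ [v])" if q: "q \<in> ?P" for q
      using compose[OF extend[OF q], of n b] last_block[of "permute_list q (vs @ [v])" n b] b len q
      by (simp add: permute_list_snoc del: scaleR_scaleR)
    then show "T b = alternation n (\<lambda>us. F (us @ [v])) vs"
      unfolding T_def alternation_def by (rule sum.cong[OF refl])
  qed
  also have "(\<Sum>b\<in>{..<m}. T b) = (\<Sum>b\<in>{..<m}. T (m - 1))"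
  proof (rule sum.cong[OF refl])
    fix b assume b: "b \<in> {..<m}"
    define c where "c = m - 1"
    have c: "b \<le> c" "c < m" "c \<le> n"
      using b len by (auto simp: c_def)
    consider "b = c" | "b < c" "c = n" | "b < c" "c < n"
      using c by linarith
    then have "T b = T c"
    proof cases
      case 2
      have "t (q \<circ> transpose n b) = t (q \<circ> transpose n c)" if q: "q \<in> ?P" for q
        using compose[OF extend[OF q], of n b] compose[OF extend[OF q], of n c]
          first_block[of "permute_list q (vs @ [v])" n b] first_block[of "permute_list q (vs @ [v])" n c] 2 b c len
        by (simp del: scaleR_scaleR)
      then show ?thesis
        unfolding T_def by (rule sum.cong[OF refl])
    next
      case 3
      \<comment> \<open>Replacing \<open>q\<close> by \<open>q \<circ> transpose b c\<close> turns the place \<open>b\<close> into the place \<open>c\<close>, up to a transposition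
        inside the first block, whose sign cancels.\<close>
      have bc: "transpose b c permutes {..<n}"
        using 3 by (intro permutes_swap_id) auto
      have "T b = (\<Sum>q\<in>?P. t (q \<circ> transpose b c \<circ> transpose n b))"
        unfolding T_def by (rule sum_permutations_compose_right[OF bc])
      also have "\<dots> = T c"
        unfolding T_def
      proof (rule sum.cong[OF refl])
        fix q assume q: "q \<in> ?P"
        have "transpose b c \<circ> transpose n b = transpose n c \<circ> transpose b c"
          using 3 by (auto simp: fun_eq_iff Transposition.transpose_def)
        then have "q \<circ> transpose b c \<circ> transpose n b = q \<circ> transpose n c \<circ> transpose b c"
          by (simp add: comp_assoc)
        moreover have nc: "transpose n c permutes {..<Suc n}"
          using c by (intro permutes_swap_id) auto
        then have qc: "q \<circ> transpose n c permutes {..<Suc n}"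
          using extend[OF q] by (rule permutes_compose)
        moreover have "t (q \<circ> transpose n c \<circ> transpose b c) = t (q \<circ> transpose n c)"
          using compose[OF qc, of b c] first_block[of "permute_list (q \<circ> transpose n c) (vs @ [v])" b c] b c len
          by (simp add: t_def del: scaleR_scaleR)
        ultimately show "t (q \<circ> transpose b c \<circ> transpose n b) = t (q \<circ> transpose n c)"
          by simp
      qed
      finally show ?thesis .
    qed simp
    then show "T b = T (m - 1)"
      by (simp add: c_def)
  qed
  also have "(\<Sum>b\<in>{..<m}. T (m - 1)) = (\<Sum>b\<in>{..<m}. alternation n (\<lambda>us. of_int (sign (transpose n (m - 1))) *\<^sub>R
      F (permute_list (transpose n (m - 1)) (us @ [v]))) vs)"
  proof (rule sum.cong[OF refl])
    have "t (q \<circ> transpose n (m - 1)) = of_int (sign q) *\<^sub>R of_int (sign (transpose n (m - 1))) *\<^sub>R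
      F (permute_list (transpose n (m - 1)) (permute_list q vs @ [v]))" if q: "q \<in> ?P" for q
      using compose[OF extend[OF q], of n "m - 1"] len q by (simp add: permute_list_snoc)
    then show "T (m - 1) = alternation n (\<lambda>us. of_int (sign (transpose n (m - 1))) *\<^sub>R
      F (permute_list (transpose n (m - 1)) (us @ [v]))) vs"
      unfolding T_def alternation_def by (rule sum.cong[OF refl])
  qed
  finally show ?thesis
    by (simp only: sum_constant_scaleR card_atLeastLessThan card_lessThan)
qed

lemma insertion_eq_alternation:
  "insertion m p K \<Phi> vs = (if p = 0 \<or> length vs \<noteq> m + (p - 1) then 0
     else (1 / (fact m * fact (p - 1))) *\<^sub>R
       alternation (m + (p - 1)) (\<lambda>us. \<Phi> (K (take m us) # drop m us)) vs)"
  by (simp add: insertion_def alternation_def)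

lemma skew_symmetric_insertion: "skew_symmetric (m + (p - 1)) (insertion m p K \<Phi>)"
  unfolding skew_symmetric_def
  by (auto simp: insertion_eq_alternation alternation_permute scaleR_left_commute)

lemma take_permute_list:
  assumes "\<sigma> permutes {..<m}" "m \<le> length ws"
  shows "take m (permute_list \<sigma> ws) = permute_list \<sigma> (take m ws)"
  using permutes_in_image[OF assms(1)] assms(2)
  by (auto simp: permute_list_def take_map take_upt min_def)

lemma drop_permute_list:
  assumes "\<sigma> permutes {..<m}" "m \<le> length ws"
  shows "drop m (permute_list \<sigma> ws) = drop m ws"
proof (rule nth_equalityI)
  fix i assume "i < length (drop m (permute_list \<sigma> ws))"
  moreover have "\<sigma> (m + i) = m + i"
    using assms(1) by (simp add: permutes_def)
  moreover from calculation have "m + i < length ws"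
    by simp
  ultimately show "drop m (permute_list \<sigma> ws) ! i = drop m ws ! i"
    using assms(2) by (simp add: permute_list_def)
qed simp

lemma skew_form_transpose:
  assumes "skew_form n f" "length xs = n" "i < n" "j < n"
  shows "of_int (sign (transpose i j)) *\<^sub>R f (permute_list (transpose i j) xs) = f xs"
proof -
  have "transpose i j permutes {..<n}"
    using assms by (intro permutes_swap_id) auto
  then have "of_int (sign (transpose i j)) *\<^sub>R f (permute_list (transpose i j) xs) =
      of_int (sign (transpose i j)) *\<^sub>R of_int (sign (transpose i j)) *\<^sub>R f xs"
    using skew_form_permute[OF assms(1,2)] by simp
  then show ?thesis
    by (simp flip: of_int_mult)
qed

text \<open>
  The two blocks are the arguments of \<open>K\<close> and the remaining arguments of \<open>\<Phi>\<close>, of sizes \<open>m\<close> and \<open>p - 1\<close>. These sizes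
  cancel against the factorials. An argument that lands in \<open>K\<close> is brought from the end to the last place
  of \<open>K\<close> past the \<open>p - 1\<close> arguments of \<open>\<Phi>\<close>, which gives the sign.
\<close>

lemma insertion_snoc:
  assumes K: "skew_form m K" and \<Phi>: "skew_form p \<Phi>" and p: "0 < p"
  shows "insertion m p K \<Phi> (vs @ [v]) = insertion m (p - 1) K (rcontract v \<Phi>) vs +
    (if m = 0 then 0 else (- 1) ^ (p - 1) *\<^sub>R insertion (m - 1) p (rcontract v K) \<Phi> vs)"
proof (cases "Suc (length vs) = m + (p - 1)")
  case False
  have "rcontract v \<Phi> = 0" if "p = 0"
    using p that by simp
  with False p show ?thesis
    by (auto simp: insertion_def)
next
  case True
  define n where "n = length vs"
  have n: "Suc n = m + (p - 1)" "length vs = n" "m \<le> Suc n"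
    using True by (simp_all add: n_def)
  let ?F = "\<lambda>us. \<Phi> (K (take m us) # drop m us)"
  let ?\<tau> = "transpose n (m - 1)"
  have snoc: "alternation (Suc n) ?F (vs @ [v]) =
    real (Suc n - m) *\<^sub>R alternation n (\<lambda>us. ?F (us @ [v])) vs +
    real m *\<^sub>R alternation n (\<lambda>us. of_int (sign ?\<tau>) *\<^sub>R ?F (permute_list ?\<tau> (us @ [v]))) vs"
  proof (rule alternation_snoc[OF n(2,3)])
    fix i j and ws :: "'a list"
    assume ws: "length ws = Suc n" and ij: "i < m" "j < m"
    have per: "transpose i j permutes {..<m}"
      using ij by (intro permutes_swap_id) auto
    have lin: "linear (\<lambda>x. \<Phi> (x # drop m ws))"
      using slotwise_linear_first[OF skew_form_slotwise_linear[OF \<Phi>]] .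
    show "of_int (sign (transpose i j)) *\<^sub>R ?F (permute_list (transpose i j) ws) = ?F ws"
      using skew_form_transpose[OF K, of "take m ws" i j] per ij ws n(3)
      by (simp add: take_permute_list drop_permute_list flip: linear_scale[OF lin])
  next
    fix i j and ws :: "'a list"
    assume ws: "length ws = Suc n" and ij: "m \<le> i" "i \<le> n" "m \<le> j" "j \<le> n"
    have per: "transpose i j permutes {..<length ws}"
      using ij ws by (intro permutes_swap_id) auto
    have nth: "permute_list (transpose i j) ws ! a = ws ! transpose i j a" if "a < length ws" for a
      using permute_list_nth[OF per that] .
    have "take m (permute_list (transpose i j) ws) = take m ws"
      by (rule nth_equalityI) (use ij ws in \<open>auto simp: nth transpose_apply_other\<close>)
    moreover have "k # drop m (permute_list (transpose i j) ws) =
      permute_list (transpose (Suc (i - m)) (Suc (j - m))) (k # drop m ws)" for k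
    proof (rule nth_equalityI)
      fix a assume a: "a < length (k # drop m (permute_list (transpose i j) ws))"
      have per': "transpose (Suc (i - m)) (Suc (j - m)) permutes {..<length (k # drop m ws)}"
        using ij ws by (intro permutes_swap_id) auto
      have "transpose (Suc (i - m)) (Suc (j - m)) (Suc b) = Suc (transpose i j (m + b) - m)"
        "m \<le> transpose i j (m + b)" for b
        using ij by (auto simp: Transposition.transpose_def)
      then show "(k # drop m (permute_list (transpose i j) ws)) ! a =
        permute_list (transpose (Suc (i - m)) (Suc (j - m))) (k # drop m ws) ! a"
        using permute_list_nth[OF per', of a] a ij ws
        by (cases a) (auto simp: nth transpose_apply_other)
    qed simp
    moreover have "Suc (i - m) < p" "Suc (j - m) < p" "length (K (take m ws) # drop m ws) = p"
      using ij ws n p by auto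
    moreover have "sign (transpose i j) = sign (transpose (Suc (i - m)) (Suc (j - m)))"
      using ij by (auto simp: sign_swap_id)
    ultimately show "of_int (sign (transpose i j)) *\<^sub>R ?F (permute_list (transpose i j) ws) = ?F ws"
      using skew_form_transpose[OF \<Phi>, of "K (take m ws) # drop m ws" "Suc (i - m)" "Suc (j - m)"]
      by simp
  qed
  have first: "real (Suc n - m) *\<^sub>R alternation n (\<lambda>us. ?F (us @ [v])) vs =
    real (p - 1) *\<^sub>R alternation n (\<lambda>us. rcontract v \<Phi> (K (take m us) # drop m us)) vs"
  proof (cases "p = 1")
    case False
    then have "m \<le> n"
      using n p by simp
    then have "alternation n (\<lambda>us. ?F (us @ [v])) vs =
      alternation n (\<lambda>us. rcontract v \<Phi> (K (take m us) # drop m us)) vs"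
      unfolding alternation_def rcontract_def
      by (intro sum.cong refl) (simp add: n(2))
    then show ?thesis
      using n by simp
  qed (use n in simp)
  have second: "alternation n (\<lambda>us. of_int (sign ?\<tau>) *\<^sub>R ?F (permute_list ?\<tau> (us @ [v]))) vs =
    (- 1) ^ (p - 1) *\<^sub>R alternation n (\<lambda>us. \<Phi> (rcontract v K (take (m - 1) us) # drop (m - 1) us)) vs"
    if m: "0 < m"
  proof -
    have "of_int (sign ?\<tau>) *\<^sub>R ?F (permute_list ?\<tau> (us @ [v])) =
      (- 1) ^ (p - 1) *\<^sub>R \<Phi> (rcontract v K (take (m - 1) us) # drop (m - 1) us)"
      if us: "length us = n" for us
    proof (cases "p = 1")
      case True
      then have "m = Suc n"
        using n by simp
      then show ?thesis
        using us True by (simp add: rcontract_def)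
    next
      case False
      then have mn: "m \<le> n" "n - m = p - 2"
        using n p by simp_all
      \<comment> \<open>Write \<open>us\<close> as \<open>A @ x # C\<close>. The transposition exchanges \<open>v\<close> with \<open>x\<close>, the last argument of \<open>K\<close>, and \<open>x\<close> is
        then moved back in front of \<open>C\<close>.\<close>
      define A x C where "A = take (m - 1) us" and "x = us ! (m - 1)" and "C = drop m us"
      have us_eq: "us = A @ x # C"
        using mn m us id_take_nth_drop[of "m - 1" us] by (simp add: A_def x_def C_def)
      have lenA: "length A = m - 1" and lenC: "length C = p - 2"
        using mn us by (simp_all add: A_def C_def)
      have "n = Suc (length A + length C)"
        using lenA lenC mn m by simp
      then have "permute_list ?\<tau> (us @ [v]) = A @ v # C @ [x]"
        using permute_list_transpose[of A C x v "[]"] lenA us_eq by (simp add: transpose_commute)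
      moreover have "sign ?\<tau> = - 1"
        using mn m by (auto simp: sign_swap_id)
      moreover have "take m (A @ v # C @ [x]) = A @ [v]" "drop m (A @ v # C @ [x]) = C @ [x]"
        using lenA m by (simp_all add: take_Cons' drop_Cons')
      moreover have "\<Phi> (k # C @ [x]) = (- 1) ^ (p - 2) *\<^sub>R \<Phi> (k # x # C)" for k
        using alternating_move[OF skew_form_alternating[OF \<Phi>], of "[k]" C x] lenC by simp
      moreover have "take (m - 1) us = A" "drop (m - 1) us = x # C"
        using us_eq lenA by simp_all
      moreover have "p - 1 = Suc (p - 2)"
        using p False by simp
      ultimately show ?thesis
        by (simp add: rcontract_def)
    qed
    then show ?thesis
      unfolding alternation_def scaleR_sum_right
      by (intro sum.cong refl) (simp add: n(2) scaleR_left_commute)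
  qed
  have "insertion m p K \<Phi> (vs @ [v]) = (1 / (fact m * fact (p - 1))) *\<^sub>R alternation (Suc n) ?F (vs @ [v])"
    using p n by (simp add: insertion_eq_alternation)
  also have "\<dots> = (real (p - 1) / (fact m * fact (p - 1))) *\<^sub>R
      alternation n (\<lambda>us. rcontract v \<Phi> (K (take m us) # drop m us)) vs +
    (real m / (fact m * fact (p - 1))) *\<^sub>R
      alternation n (\<lambda>us. of_int (sign ?\<tau>) *\<^sub>R ?F (permute_list ?\<tau> (us @ [v]))) vs"
    unfolding snoc first by (simp add: scaleR_add_right)
  also have "(real (p - 1) / (fact m * fact (p - 1))) *\<^sub>R
      alternation n (\<lambda>us. rcontract v \<Phi> (K (take m us) # drop m us)) vs = insertion m (p - 1) K (rcontract v \<Phi>) vs"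
  proof (cases "p = 1")
    case False
    then obtain q where "p = Suc (Suc q)"
      using p by (metis One_nat_def gr0_implies_Suc not0_implies_Suc)
    then show ?thesis
      using n by (simp add: insertion_eq_alternation divide_simps)
  qed (simp add: insertion_def)
  also have "(real m / (fact m * fact (p - 1))) *\<^sub>R
      alternation n (\<lambda>us. of_int (sign ?\<tau>) *\<^sub>R ?F (permute_list ?\<tau> (us @ [v]))) vs =
    (if m = 0 then 0 else (- 1) ^ (p - 1) *\<^sub>R insertion (m - 1) p (rcontract v K) \<Phi> vs)"
  proof (cases m)
    case (Suc m')
    have "real m / (fact m * fact (p - 1)) = 1 / (fact m' * fact (p - 1))"
      by (simp add: Suc)
    then show ?thesis
      using second n p by (auto simp: Suc insertion_eq_alternation scaleR_left_commute)
  qed simp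
  finally show ?thesis .
qed

lemma alternation_scale: "alternation n (\<lambda>us. c *\<^sub>R F us) vs = c *\<^sub>R alternation n F vs"
  by (simp add: alternation_def scaleR_sum_right mult.commute)

lemma insertion_scale_right: "insertion m p K (c *\<^sub>R \<Phi>) vs = c *\<^sub>R insertion m p K \<Phi> vs"
  by (simp add: insertion_eq_alternation scaleR_fun_apply alternation_scale scaleR_left_commute)

lemma insertion_scale_left:
  assumes "slotwise_linear \<Phi>"
  shows "insertion m p (c *\<^sub>R K) \<Phi> vs = c *\<^sub>R insertion m p K \<Phi> vs"
  by (simp add: insertion_eq_alternation scaleR_fun_apply alternation_scale scaleR_left_commute
      linear_scale[OF slotwise_linear_first[OF assms]])

text \<open>
  The first argument is moved to the end, \<open>insertion_snoc\<close> is applied, and the appended argument of \<open>K\<close>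
  or \<open>\<Phi>\<close> is moved back to the front. The three signs multiply to those in the recursion for \<open>ins\<close>.
\<close>

lemma insertion_Cons:
  assumes K: "skew_form m K" and \<Phi>: "skew_form p \<Phi>" and p: "0 < p"
  shows "insertion m p K \<Phi> (v # vs) = (if m = 0 then 0 else insertion (m - 1) p (contract v K) \<Phi> vs) +
    sg (int m - 1) *\<^sub>R insertion m (p - 1) K (contract v \<Phi>) vs"
proof (cases "Suc (length vs) = m + (p - 1)")
  case False
  then show ?thesis
    using p by (auto simp: insertion_def)
next
  case True
  obtain q where q: "p = Suc q"
    using p by (cases p) auto
  define n where "n = length vs"
  have "alternating (insertion m p K \<Phi>)"
    by (rule skew_symmetric_imp_alternating[OF _ skew_symmetric_insertion]) (simp add: insertion_def)
  then have "insertion m p K \<Phi> (vs @ [v]) = (- 1) ^ n *\<^sub>R insertion m p K \<Phi> (v # vs)"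
    using alternating_move[of _ "[]" vs v] by (simp add: n_def)
  then have "insertion m p K \<Phi> (v # vs) = (- 1) ^ n *\<^sub>R insertion m p K \<Phi> (vs @ [v])"
    by (simp flip: power_mult_distrib)
  also have "insertion m p K \<Phi> (vs @ [v]) = (- 1) ^ q *\<^sub>R insertion m q K (contract v \<Phi>) vs +
    (if m = 0 then 0 else (- 1) ^ q *\<^sub>R (- 1) ^ (m - 1) *\<^sub>R insertion (m - 1) p (contract v K) \<Phi> vs)"
  proof -
    have "rcontract v \<Phi> = (- 1) ^ q *\<^sub>R contract v \<Phi>"
      using contract_eq_rcontract[of q \<Phi> v] \<Phi> q by (simp flip: power_mult_distrib)
    moreover have "rcontract v K = (- 1) ^ (m - 1) *\<^sub>R contract v K" if "m \<noteq> 0"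
      using contract_eq_rcontract[of "m - 1" K v] K that by (simp flip: power_mult_distrib)
    ultimately show ?thesis
      using insertion_snoc[OF K \<Phi> p, of vs v] q
      by (simp add: insertion_scale_right insertion_scale_left skew_form_slotwise_linear[OF \<Phi>])
  qed
  also have "(- 1) ^ n *\<^sub>R \<dots> = (if m = 0 then 0 else insertion (m - 1) p (contract v K) \<Phi> vs) +
    sg (int m - 1) *\<^sub>R insertion m (p - 1) K (contract v \<Phi>) vs"
  proof (cases m)
    case 0
    then have "q = Suc n"
      using True q by (simp add: n_def)
    then show ?thesis
      using 0 q by (simp flip: power_mult_distrib)
  next
    case (Suc j)
    then have "n = j + q"
      using True q by (simp add: n_def)
    then have n: "(- 1) ^ n = ((- 1) ^ j * (- 1) ^ q :: real)"
      by (simp add: power_add)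
    have sq: "(- 1) ^ i * (- 1) ^ i = (1::real)" for i
      by (simp flip: power_mult_distrib)
    have nq: "(- 1) ^ n * (- 1) ^ q = ((- 1) ^ j :: real)"
      by (simp only: n mult.assoc sq mult_1_right)
    moreover have "(- 1) ^ n * ((- 1) ^ q * (- 1) ^ j) = (1::real)"
      by (simp only: mult.assoc[symmetric] nq sq)
    ultimately show ?thesis
      using Suc q by (simp add: scaleR_add_right)
  qed
  finally show ?thesis .
qed

lemma ins_arity_0:
  assumes "\<And>x xs. \<Phi> (x # xs) = 0"
  shows "ins k K \<Phi> vs = 0"
  using assms
proof (induction vs arbitrary: k K \<Phi>)
  case (Cons v vs)
  have "contract v \<Phi> = 0"
    by (simp add: fun_eq_iff contract_apply Cons.prems)
  then show ?case
    by (simp add: Cons)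
qed simp

lemma contract_arity_0: "skew_form 0 f \<Longrightarrow> contract v f = 0"
  using skew_form_length[of 0 f] by (simp add: fun_eq_iff contract_apply)

text \<open>
  Both sides satisfy the same recursion. The truncated arities of \<open>insertion\<close> agree with the integer
  degrees of \<open>ins\<close> except for \<open>m = 0\<close> and \<open>p = 0\<close>. There a contraction vanishes: that of \<open>K\<close> if \<open>m = 0\<close>, that of \<open>\<Phi>\<close> if
  \<open>p = 0\<close>.
\<close>

theorem insertion_eq_ins:
  assumes "skew_form m K" "skew_form p \<Phi>"
  shows "insertion m p K \<Phi> = ins (int m - 1) K \<Phi>"
proof
  fix vs
  show "insertion m p K \<Phi> vs = ins (int m - 1) K \<Phi> vs"
    using assms
  proof (induction vs arbitrary: m p K \<Phi>)
    case Nil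
    show ?case
    proof (cases "m = 0 \<and> p = 1")
      case True
      then show ?thesis
        by (simp add: insertion_def sign_id)
    next
      case False
      moreover have "\<Phi> [K []] = 0"
      proof (cases "p = 1")
        case True
        then have "K [] = 0"
          using False Nil(1) by (intro skew_form_length) auto
        then show ?thesis
          using linear_0[OF slotwise_linear_first[OF skew_form_slotwise_linear[OF Nil(2)]]] by simp
      qed (simp add: skew_form_length[OF Nil(2)])
      ultimately show ?thesis
        by (auto simp: insertion_def)
    qed
  next
    case (Cons v vs)
    show ?case
    proof (cases p)
      case 0
      then have "ins (int m - 1) K \<Phi> (v # vs) = 0"
        using skew_form_length[OF Cons.prems(2)] by (intro ins_arity_0) simp
      then show ?thesis
        by (simp add: insertion_def 0 del: ins.simps)
    next
      case (Suc q)
      have IH: "insertion m q K (contract v \<Phi>) vs = ins (int m - 1) K (contract v \<Phi>) vs"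
        using Cons.IH[OF Cons.prems(1)] Cons.prems(2) Suc by (simp add: skew_form_contract)
      show ?thesis
      proof (cases m)
        case 0
        then have "contract v K = 0"
          using Cons.prems(1) contract_arity_0 by blast
        then show ?thesis
          using insertion_Cons[OF Cons.prems, of v vs] IH Suc 0
            ins_zero_left[OF skew_form_slotwise_linear[OF Cons.prems(2)]]
          by simp
      next
        case (Suc j)
        then have "insertion j p (contract v K) \<Phi> vs = ins (int j - 1) (contract v K) \<Phi> vs"
          using Cons.IH[OF _ Cons.prems(2)] Cons.prems(1) by (simp add: skew_form_contract)
        then show ?thesis
          using insertion_Cons[OF Cons.prems, of v vs] IH Suc \<open>p = Suc q\<close> by simp
      qed
    qed
  qed
qed

section \<open>Polyderivations and the cup product\<close>

text \<open>
  The shuffle product \<open>\<Sum> \<plusminus> P (\<dots>) Q (\<dots>)\<close> for \<open>P\<close> with \<open>g\<close> arguments, by recursion over the arguments: the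
  first one goes to \<open>P\<close>, or past the \<open>g\<close> arguments of \<open>P\<close> to \<open>Q\<close>. The multiplication is a parameter,
  so that the opposite multiplication gives the products with \<open>Q\<close> on the left.
\<close>

fun cup :: "('a \<Rightarrow> 'a \<Rightarrow> 'a) \<Rightarrow> int \<Rightarrow> ('a::real_vector list \<Rightarrow> 'a) \<Rightarrow> ('a list \<Rightarrow> 'a) \<Rightarrow> 'a list \<Rightarrow> 'a" where
  "cup mul g P Q [] = mul (P []) (Q [])"
| "cup mul g P Q (v # vs) = cup mul (g - 1) (contract v P) Q vs + sg g *\<^sub>R cup mul g P (contract v Q) vs"

lemma cup_uminus_right:
  assumes "bilinear mul"
  shows "cup mul g P (- Q) vs = - cup mul g P Q vs"
  by (induction vs arbitrary: g P Q) (simp_all add: bilinear_rneg[OF assms])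

lemma bilinear_flip: "bilinear mul \<Longrightarrow> bilinear (\<lambda>x y. mul y x)"
  by (simp add: bilinear_def)

text \<open>
  The values are multiplied in the order \<open>P\<close>, \<open>Q\<close> on both sides; only the order in which the two
  maps take their arguments differs. Moving the \<open>g\<close> arguments of \<open>P\<close> past the \<open>h\<close> arguments of \<open>Q\<close> gives the sign.
\<close>

lemma cup_flip:
  assumes "bilinear mul" "homogeneous (g - 1) P" "homogeneous (h - 1) Q"
  shows "cup (\<lambda>x y. mul y x) h Q P vs = sg (g * h) *\<^sub>R cup mul g P Q vs"
  using assms(2,3)
proof (induction vs arbitrary: g h P Q)
  case Nil
  have "P [] = 0 \<or> Q [] = 0 \<or> g * h = 0"
    using homogeneous_Nil[OF Nil(1)] by auto
  then show ?case
    using bilinear_lzero[OF assms(1)] bilinear_rzero[OF assms(1)] by auto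
next
  case (Cons v vs)
  have "cup (\<lambda>x y. mul y x) (h - 1) (contract v Q) P vs = sg (g * (h - 1)) *\<^sub>R cup mul g P (contract v Q) vs"
    using Cons.prems by (intro Cons.IH homogeneous_contract)
  moreover have "cup (\<lambda>x y. mul y x) h Q (contract v P) vs = sg ((g - 1) * h) *\<^sub>R cup mul (g - 1) (contract v P) Q vs"
    using Cons.prems by (intro Cons.IH homogeneous_contract)
  moreover have "sg h * (sg (g * h) * sg h) = sg (g * h)"
    by (simp add: mult.left_commute)
  ultimately show ?case
    by (simp add: sg_mult_pred_left sg_mult_pred_right scaleR_add_right)
qed

text \<open>
  The product rule is required in every slot and not only in the first one, so that contractions inherit it.
\<close>

definition leibniz :: "('a::real_vector \<Rightarrow> 'a \<Rightarrow> 'a) \<Rightarrow> ('a list \<Rightarrow> 'a) \<Rightarrow> bool" where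
  "leibniz mul f \<longleftrightarrow>
     (\<forall>us ws a b. f (us @ mul a b # ws) = mul (f (us @ a # ws)) b + mul a (f (us @ b # ws)))"

lemma leibnizD: "leibniz mul f \<Longrightarrow> f (us @ mul a b # ws) = mul (f (us @ a # ws)) b + mul a (f (us @ b # ws))"
  unfolding leibniz_def by blast

lemma leibniz_contract:
  assumes "leibniz mul f"
  shows "leibniz mul (contract v f)"
  unfolding leibniz_def contract_apply
proof (intro allI)
  show "f (v # us @ mul a b # ws) = mul (f (v # us @ a # ws)) b + mul a (f (v # us @ b # ws))" for us ws a b
    using leibnizD[OF assms, of "v # us" a b ws] by simp
qed

lemma leibniz_flip: "leibniz mul f \<Longrightarrow> leibniz (\<lambda>x y. mul y x) f"
  by (auto simp: leibniz_def)

text \<open>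
  By the product rule \<open>L (P b, \<dots>) = L (P, \<dots>) b + P L (b, \<dots>)\<close> for the slot into which \<open>P\<close> is inserted. The
  second term is the cup product. Here \<open>f\<close> is the degree of \<open>P\<close>, so its number of arguments is \<open>f + 1\<close>.
\<close>

lemma ins_mult_right:
  assumes "bilinear mul" "alternating L" "leibniz mul L"
  shows "ins f (\<lambda>xs. mul (P xs) b) L vs = mul (ins f P L vs) b + cup mul (f + 1) P (contract b L) vs"
  using assms(2,3)
proof (induction vs arbitrary: f P L)
  case Nil
  show ?case
    using leibnizD[OF Nil(2), of "[]" "P []" b "[]"] by (simp add: contract_apply)
next
  case (Cons v vs)
  have 1: "ins (f - 1) (contract v (\<lambda>xs. mul (P xs) b)) L vs =
    mul (ins (f - 1) (contract v P) L vs) b + cup mul (f + 1 - 1) (contract v P) (contract b L) vs"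
    using Cons.IH[OF Cons.prems, of "f - 1" "contract v P"] by (simp add: contract_def)
  have 2: "ins f (\<lambda>xs. mul (P xs) b) (contract v L) vs =
    mul (ins f P (contract v L) vs) b - cup mul (f + 1) P (contract v (contract b L)) vs"
    using Cons.IH[OF alternating_contract[OF Cons.prems(1), of v] leibniz_contract[OF Cons.prems(2), of v], of f P]
    unfolding alternating_swap[OF Cons.prems(1), where y = b and x = v] cup_uminus_right[OF assms(1)] by simp
  have "sg (f + 1) = - sg f"
    using sg_pred[of "f + 1"] by simp
  then show ?case
    by (simp only: ins.simps cup.simps 1 2) (simp add: bilinear_ladd[OF assms(1)] bilinear_lmul[OF assms(1)] scaleR_diff_right)
qed

lemma ins_mult_left:
  assumes "bilinear mul" "alternating L" "leibniz mul L"
  shows "ins f (\<lambda>xs. mul a (P xs)) L vs =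
    mul a (ins f P L vs) + cup (\<lambda>x y. mul y x) (f + 1) P (contract a L) vs"
  using ins_mult_right[OF bilinear_flip[OF assms(1)] assms(2) leibniz_flip[OF assms(3)]] .

lemma linear_of_bilinear:
  assumes "bilinear mul"
  shows "linear (\<lambda>x. mul x b)" "linear (\<lambda>x. mul a x)"
  using assms unfolding bilinear_def by blast+

lemma contract_leibniz:
  assumes "leibniz mul K"
  shows "contract (mul a b) K = (\<lambda>xs. mul (contract a K xs) b) + (\<lambda>xs. mul a (contract b K xs))"
proof
  show "contract (mul a b) K xs = ((\<lambda>xs. mul (contract a K xs) b) + (\<lambda>xs. mul a (contract b K xs))) xs" for xs
    using leibnizD[OF assms, of "[]" a b xs] by (simp add: contract_apply)
qed

lemma ins_leibniz_defect:
  assumes mul: "bilinear mul" and K: "leibniz mul K"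
    and L: "slotwise_linear L" "alternating L" "leibniz mul L"
  shows "ins k K L (mul a b # vs) = mul (ins k K L (a # vs)) b + mul a (ins k K L (b # vs)) +
    cup mul k (contract a K) (contract b L) vs + cup (\<lambda>x y. mul y x) k (contract b K) (contract a L) vs"
proof -
  have 1: "ins (k - 1) (contract (mul a b) K) L vs =
    mul (ins (k - 1) (contract a K) L vs) b + cup mul k (contract a K) (contract b L) vs +
    (mul a (ins (k - 1) (contract b K) L vs) + cup (\<lambda>x y. mul y x) k (contract b K) (contract a L) vs)"
    using ins_mult_right[OF mul L(2,3), of "k - 1" "contract a K" b vs]
      ins_mult_left[OF mul L(2,3), of "k - 1" a "contract b K" vs]
    by (simp add: contract_leibniz[OF K] ins_add_left[OF L(1)])
  have 2: "ins k K (contract (mul a b) L) vs = mul (ins k K (contract a L) vs) b + mul a (ins k K (contract b L) vs)"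
    by (simp add: contract_leibniz[OF L(3)] ins_add_right ins_linear_right[OF linear_of_bilinear(1)[OF mul]]
        ins_linear_right[OF linear_of_bilinear(2)[OF mul]])
  show ?thesis
    by (simp add: 1 2 bilinear_ladd[OF mul] bilinear_radd[OF mul] bilinear_lmul[OF mul] bilinear_rmul[OF mul]
        scaleR_add_right)
qed

text \<open>
  The defects of \<open>i\<^sub>K L\<close> and of \<open>i\<^sub>L K\<close> consist of the same two cup products up to the sign \<open>(- 1)\<^sup>k\<^sup>l\<close>, which
  is the factor of \<open>i\<^sub>L K\<close> in the bracket.
\<close>

theorem bracket_leibniz:
  assumes mul: "bilinear mul"
    and K: "homogeneous k K" "slotwise_linear K" "alternating K" "leibniz mul K"
    and L: "homogeneous l L" "slotwise_linear L" "alternating L" "leibniz mul L"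
    and B: "B = ins k K L - sg (k * l) *\<^sub>R ins l L K"
  shows "B (mul a b # vs) = mul (B (a # vs)) b + mul a (B (b # vs))"
proof -
  have flip1: "cup (\<lambda>x y. mul y x) l (contract b L) (contract a K) vs =
    sg (k * l) *\<^sub>R cup mul k (contract a K) (contract b L) vs"
    by (rule cup_flip[OF mul homogeneous_contract[OF K(1)] homogeneous_contract[OF L(1)]])
  have flip2: "cup (\<lambda>x y. mul y x) k (contract b K) (contract a L) vs =
    sg (k * l) *\<^sub>R cup mul l (contract a L) (contract b K) vs"
    using cup_flip[OF mul homogeneous_contract[OF L(1)] homogeneous_contract[OF K(1)]]
    by (simp add: mult.commute)
  have B': "B (x # vs) = ins k K L (x # vs) - sg (k * l) *\<^sub>R ins l L K (x # vs)" for x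
    by (simp add: B scaleR_fun_apply del: ins.simps)
  show ?thesis
    unfolding B' ins_leibniz_defect[OF mul K(4) L(2-4)] ins_leibniz_defect[OF mul L(4) K(2-4)] flip1 flip2
    by (simp add: bilinear_lsub[OF mul] bilinear_rsub[OF mul] bilinear_lmul[OF mul] bilinear_rmul[OF mul]
        scaleR_add_right del: ins.simps)
qed

lemma alternating_move_front:
  assumes "alternating f"
  shows "f (us @ x # ws) = (- 1) ^ length us *\<^sub>R f (x # us @ ws)"
proof (induction us arbitrary: ws rule: rev_induct)
  case (snoc u us)
  then show ?case
    using alternatingD[OF assms, of us u x ws] by simp
qed simp

lemma leibnizI:
  assumes mul: "bilinear mul" and f: "alternating f"
    and first: "\<And>a b ws. f (mul a b # ws) = mul (f (a # ws)) b + mul a (f (b # ws))"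
  shows "leibniz mul f"
  unfolding leibniz_def
proof (intro allI)
  show "f (us @ mul a b # ws) = mul (f (us @ a # ws)) b + mul a (f (us @ b # ws))" for us ws a b
    by (simp add: alternating_move_front[OF f, of us] first bilinear_lmul[OF mul] bilinear_rmul[OF mul]
        scaleR_add_right)
qed

section \<open>The Nijenhuis-Richardson algebra\<close>

context convenient_base
begin

text \<open>
  Uniform boundedness without reference to the arity, so that contraction with the elements of a bounded set stays
  within the same notion. For maps that vanish outside one length both notions agree.
\<close>

definition bounded_family :: "('a list \<Rightarrow> 'a) set \<Rightarrow> bool" where
  "bounded_family S \<longleftrightarrow> (\<forall>Bs. (\<forall>B\<in>set Bs. vn_bounded T B) \<longrightarrow>
     vn_bounded T {f xs | f xs. f \<in> S \<and> xs \<in> listset Bs})"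

lemma bounded_familyD:
  "bounded_family S \<Longrightarrow> (\<And>B. B \<in> set Bs \<Longrightarrow> vn_bounded T B) \<Longrightarrow>
     vn_bounded T {f xs | f xs. f \<in> S \<and> xs \<in> listset Bs}"
  unfolding bounded_family_def by blast

lemma uniformly_bounded_of_family: "bounded_family S \<Longrightarrow> uniformly_bounded T n S"
  by (simp add: bounded_family_def uniformly_bounded_def)

lemma length_listset: "xs \<in> listset Bs \<Longrightarrow> length xs = length Bs"
  by (induction Bs arbitrary: xs) (auto simp: set_Cons_def)

lemma bounded_family_of_uniformly_bounded:
  assumes "S \<subseteq> skew_maps T n" "uniformly_bounded T n S"
  shows "bounded_family S"
  unfolding bounded_family_def
proof (intro allI impI)
  fix Bs assume Bs: "\<forall>B\<in>set Bs. vn_bounded T B"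
  show "vn_bounded T {f xs | f xs. f \<in> S \<and> xs \<in> listset Bs}"
  proof (cases "length Bs = n")
    case True
    then show ?thesis
      using assms(2) Bs by (intro uniformly_boundedD)
  next
    case False
    then have "{f xs | f xs. f \<in> S \<and> xs \<in> listset Bs} \<subseteq> {0}"
      using assms(1) by (auto simp: skew_maps_def multilinear_def dest!: length_listset)
    then show ?thesis
      by (rule bounded_subset[OF bounded_singleton])
  qed
qed

lemma bounded_family_contract:
  assumes "bounded_family S" "vn_bounded T B"
  shows "bounded_family {contract v f | v f. v \<in> B \<and> f \<in> S}"
  unfolding bounded_family_def
proof (intro allI impI)
  fix Bs assume "\<forall>B\<in>set Bs. vn_bounded T B"
  then have "vn_bounded T {f xs | f xs. f \<in> S \<and> xs \<in> listset (B # Bs)}"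
    using assms by (intro bounded_familyD) auto
  then show "vn_bounded T {f xs | f xs. f \<in> {contract v f | v f. v \<in> B \<and> f \<in> S} \<and> xs \<in> listset Bs}"
    by (rule bounded_subset) (fastforce simp: contract_apply set_Cons_def)
qed

text \<open>
  By the recursion a value of \<open>i\<^sub>K \<Phi>\<close> is a sum of two values, for fewer arguments, of insertions of contracted maps,
  and the contractions of a bounded family by a bounded set form a bounded family.
\<close>

lemma bounded_ins:
  assumes "bounded_family S" "bounded_family S'" "\<And>B. B \<in> set Bs \<Longrightarrow> vn_bounded T B"
  shows "vn_bounded T {ins k K \<Phi> vs | K \<Phi> vs. K \<in> S \<and> \<Phi> \<in> S' \<and> vs \<in> listset Bs}"
  using assms
proof (induction Bs arbitrary: k S S')
  case Nil
  have "vn_bounded T {K xs | K xs. K \<in> S \<and> xs \<in> listset []}"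
    using Nil(1) by (rule bounded_familyD) simp
  then have "vn_bounded T {\<Phi> xs | \<Phi> xs. \<Phi> \<in> S' \<and> xs \<in> listset [{K xs | K xs. K \<in> S \<and> xs \<in> listset []}]}"
    by (intro bounded_familyD[OF Nil(2)]) simp
  then show ?case
    by (rule bounded_subset) (fastforce simp: set_Cons_def)
next
  case (Cons B Bs)
  have B: "vn_bounded T B" and Bs: "\<And>B. B \<in> set Bs \<Longrightarrow> vn_bounded T B"
    using Cons.prems(3) by auto
  let ?X = "{ins (k - 1) K \<Phi> vs | K \<Phi> vs. K \<in> {contract v f | v f. v \<in> B \<and> f \<in> S} \<and> \<Phi> \<in> S' \<and> vs \<in> listset Bs}"
  let ?Y = "{ins k K \<Phi> vs | K \<Phi> vs. K \<in> S \<and> \<Phi> \<in> {contract v f | v f. v \<in> B \<and> f \<in> S'} \<and> vs \<in> listset Bs}"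
  have "vn_bounded T ?X"
    using bounded_family_contract[OF Cons.prems(1) B] Cons.prems(2) Bs by (rule Cons.IH)
  moreover have "vn_bounded T ?Y"
    using Cons.prems(1) bounded_family_contract[OF Cons.prems(2) B] Bs by (rule Cons.IH)
  ultimately have bounded: "vn_bounded T {x + y | x y. x \<in> ?X \<and> y \<in> (*\<^sub>R) (sg k) ` ?Y}"
    by (intro bounded_add bounded_scale)
  show ?case
  proof (rule bounded_subset[OF bounded], intro subsetI)
    fix z assume "z \<in> {ins k K \<Phi> vs | K \<Phi> vs. K \<in> S \<and> \<Phi> \<in> S' \<and> vs \<in> listset (B # Bs)}"
    then obtain K \<Phi> v vs where z: "z = ins k K \<Phi> (v # vs)" and "K \<in> S" "\<Phi> \<in> S'" "v \<in> B" "vs \<in> listset Bs"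
      by (auto simp: set_Cons_def simp del: ins.simps)
    then have "ins (k - 1) (contract v K) \<Phi> vs \<in> ?X" "ins k K (contract v \<Phi>) vs \<in> ?Y"
      by blast+
    then show "z \<in> {x + y | x y. x \<in> ?X \<and> y \<in> (*\<^sub>R) (sg k) ` ?Y}"
      unfolding z ins.simps by blast
  qed
qed

lemma nr_space_skew_form:
  assumes "x \<in> nr_space T k"
  shows "skew_form (nat (k + 1)) x"
proof (cases "k < - 1")
  case True
  then show ?thesis
    using assms subspace_0[OF subspace_skew_maps[of 0]] by (simp add: nr_space_def skew_form_def skew_maps_def)
next
  case False
  then show ?thesis
    using assms by (simp add: nr_space_def skew_form_def skew_maps_def)
qed

text \<open>
  In this form the components of degree below \<open>- 1\<close> fit the general pattern: a homogeneous map of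
  such a degree vanishes because no list has negative length.
\<close>

lemma nr_spaceD:
  assumes "x \<in> nr_space T k"
  shows "homogeneous k x" "slotwise_linear x" "alternating x"
proof -
  note x = nr_space_skew_form[OF assms]
  show "homogeneous k x"
  proof (cases "k < - 1")
    case True
    then show ?thesis
      using assms by (simp add: nr_space_def homogeneous_def)
  next
    case False
    then show ?thesis
      using skew_form_homogeneous[OF x] by simp
  qed
  show "slotwise_linear x" "alternating x"
    using x by (rule skew_form_slotwise_linear, rule skew_form_alternating)
qed

lemma nr_space_subset: "nr_space T k \<subseteq> skew_maps T (nat (k + 1))"
  using subspace_0[OF subspace_skew_maps] by (auto simp: nr_space_def)

lemma subspace_nr_space: "subspace (nr_space T k)"
  by (simp add: nr_space_def subspace_skew_maps subspace_single_0)

lemma insertion_eq_ins_nr_space: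
  assumes "x \<in> nr_space T k" "y \<in> nr_space T l"
  shows "insertion (nat (k + 1)) (nat (l + 1)) x y = ins k x y"
proof (cases "k < - 1")
  case True
  then have "x = 0"
    using assms(1) by (simp add: nr_space_def)
  then show ?thesis
    using insertion_eq_ins[OF nr_space_skew_form[OF assms(1)] nr_space_skew_form[OF assms(2)]]
    by (simp add: ins_zero_left[OF nr_spaceD(2)[OF assms(2)]])
next
  case False
  then show ?thesis
    using insertion_eq_ins[OF nr_space_skew_form[OF assms(1)] nr_space_skew_form[OF assms(2)]] by simp
qed

lemma nr_bracket_eq_ins:
  assumes "x \<in> nr_space T k" "y \<in> nr_space T l"
  shows "nr_bracket k l x y = ins k x y - sg (k * l) *\<^sub>R ins l y x"
  by (simp add: nr_bracket_def insertion_eq_ins_nr_space assms)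

lemma bounded_family_nr_bracket:
  assumes S: "S \<subseteq> nr_space T k" "bounded_family S" and S': "S' \<subseteq> nr_space T l" "bounded_family S'"
  shows "bounded_family {nr_bracket k l x y | x y. x \<in> S \<and> y \<in> S'}"
  unfolding bounded_family_def
proof (intro allI impI)
  fix Bs assume Bs: "\<forall>B\<in>set Bs. vn_bounded T B"
  let ?X = "{ins k x y vs | x y vs. x \<in> S \<and> y \<in> S' \<and> vs \<in> listset Bs}"
  let ?Y = "{ins l y x vs | y x vs. y \<in> S' \<and> x \<in> S \<and> vs \<in> listset Bs}"
  have "vn_bounded T ?X" "vn_bounded T ?Y"
    using Bs S(2) S'(2) by (auto intro: bounded_ins)
  then have bounded: "vn_bounded T {u + v | u v. u \<in> ?X \<and> v \<in> (*\<^sub>R) (- sg (k * l)) ` ?Y}"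
    by (intro bounded_add bounded_scale)
  show "vn_bounded T {f xs | f xs. f \<in> {nr_bracket k l x y | x y. x \<in> S \<and> y \<in> S'} \<and> xs \<in> listset Bs}"
  proof (rule bounded_subset[OF bounded], intro subsetI)
    fix z assume "z \<in> {f xs | f xs. f \<in> {nr_bracket k l x y | x y. x \<in> S \<and> y \<in> S'} \<and> xs \<in> listset Bs}"
    then obtain x y vs where z: "z = nr_bracket k l x y vs" "x \<in> S" "y \<in> S'" "vs \<in> listset Bs"
      by blast
    then have "nr_bracket k l x y = ins k x y - sg (k * l) *\<^sub>R ins l y x"
      using S(1) S'(1) by (intro nr_bracket_eq_ins) auto
    then have "z = ins k x y vs + (- sg (k * l)) *\<^sub>R ins l y x vs"
      by (simp add: z(1) scaleR_fun_apply)
    moreover have "ins k x y vs \<in> ?X" "ins l y x vs \<in> ?Y"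
      using z by blast+
    ultimately show "z \<in> {u + v | u v. u \<in> ?X \<and> v \<in> (*\<^sub>R) (- sg (k * l)) ` ?Y}"
      by blast
  qed
qed

lemma skew_symmetric_insertion_nr_space:
  assumes "x \<in> nr_space T k" "y \<in> nr_space T l"
  shows "skew_symmetric (nat (k + l + 1)) (insertion (nat (k + 1)) (nat (l + 1)) x y)"
proof (cases "k < - 1 \<or> l < 0")
  case True
  have "insertion (nat (k + 1)) (nat (l + 1)) x y = 0"
  proof (cases "l < 0")
    case True
    then show ?thesis
      by (simp add: insertion_def fun_eq_iff)
  next
    case False
    then have "x = 0"
      using \<open>k < - 1 \<or> l < 0\<close> assms(1) by (simp add: nr_space_def)
    then show ?thesis
      using insertion_eq_ins_nr_space[OF assms] ins_zero_left[OF nr_spaceD(2)[OF assms(2)]] by simp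
  qed
  then show ?thesis
    by (simp add: skew_symmetric_def)
next
  case False
  then have "nat (k + l + 1) = nat (k + 1) + (nat (l + 1) - 1)"
    by arith
  then show ?thesis
    by (simp only: skew_symmetric_insertion)
qed

lemma nr_bracket_closed:
  assumes x: "x \<in> nr_space T k" and y: "y \<in> nr_space T l"
  shows "nr_bracket k l x y \<in> nr_space T (k + l)"
proof -
  let ?b = "nr_bracket k l x y"
  have hom: "homogeneous (k + l) ?b"
    using homogeneous_ins[OF nr_spaceD(1)[OF x] nr_spaceD(1,2)[OF y]]
      homogeneous_ins[OF nr_spaceD(1)[OF y] nr_spaceD(1,2)[OF x]]
    by (simp add: nr_bracket_eq_ins[OF x y] homogeneous_def scaleR_fun_apply add.commute)
  show ?thesis
  proof (cases "k + l < - 1")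
    case True
    then have "?b xs = 0" for xs
      using hom by (simp add: homogeneous_def)
    then show ?thesis
      using True by (simp add: nr_space_def fun_eq_iff)
  next
    case False
    have "slotwise_linear ?b"
      using slotwise_linear_ins[OF nr_spaceD(2)[OF x] nr_spaceD(2)[OF y], of k]
        slotwise_linear_ins[OF nr_spaceD(2)[OF y] nr_spaceD(2)[OF x], of l]
      unfolding nr_bracket_eq_ins[OF x y] slotwise_linear_def
      by (simp add: scaleR_fun_apply linear_compose_sub linear_compose_scale_right)
    moreover have "?b xs = 0" if "length xs \<noteq> nat (k + l + 1)" for xs
      using hom that False by (auto simp: homogeneous_def)
    ultimately have "multilinear (nat (k + l + 1)) ?b"
      by (rule multilinearI)
    moreover have "skew_symmetric (nat (k + l + 1)) ?b"
      using skew_symmetric_insertion_nr_space[OF x y] skew_symmetric_insertion_nr_space[OF y x]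
      by (simp add: nr_bracket_def skew_symmetric_def scaleR_fun_apply scaleR_diff_right scaleR_left_commute
          add.commute)
    moreover have "uniformly_bounded T (nat (k + l + 1)) {?b}"
    proof -
      have fam: "bounded_family {z}" if z: "z \<in> nr_space T j" for z j
        using nr_space_subset[of j] z
        by (intro bounded_family_of_uniformly_bounded[of _ "nat (j + 1)"]) (auto simp: skew_maps_def)
      have "bounded_family {nr_bracket k l x' y' | x' y'. x' \<in> {x} \<and> y' \<in> {y}}"
        using x y by (intro bounded_family_nr_bracket fam) auto
      then show ?thesis
        by (intro uniformly_bounded_of_family) simp
    qed
    ultimately show ?thesis
      using False by (simp add: nr_space_def skew_maps_def add.assoc)
  qed
qed

text \<open>
  For the Jacobi identity, both sides are expanded into insertions. The pre-Lie identities for \<open>(x, y, z)\<close>,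
  \<open>(x, z, y)\<close> and \<open>(y, z, x)\<close> rewrite three of the six terms that insert into an insertion product,
  and then everything cancels.
\<close>

theorem nijenhuis_richardson_algebra: "graded_lie_algebra (nr_space T) nr_bracket"
  unfolding graded_lie_algebra_def
proof (intro conjI allI ballI)
  show "subspace (nr_space T k)" for k
    by (rule subspace_nr_space)
  show "nr_bracket k l x y \<in> nr_space T (k + l)" if "x \<in> nr_space T k" "y \<in> nr_space T l" for k l x y
    using that by (rule nr_bracket_closed)
  have mem: "a *\<^sub>R u + b *\<^sub>R v \<in> nr_space T k" if "u \<in> nr_space T k" "v \<in> nr_space T k" for a b u v k
    using that subspace_nr_space by (intro subspace_add subspace_scale)
  show "nr_bracket k l (a *\<^sub>R x + b *\<^sub>R x') y = a *\<^sub>R nr_bracket k l x y + b *\<^sub>R nr_bracket k l x' y"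
    if "x \<in> nr_space T k" "x' \<in> nr_space T k" "y \<in> nr_space T l" for k l x x' y a b
    using that mem[of x k x' a b]
    by (simp add: nr_bracket_eq_ins ins_add_left[OF nr_spaceD(2)] ins_scale_left[OF nr_spaceD(2)]
        ins_add_right ins_scale_right scaleR_add_right scaleR_diff_right mult.commute)
  show "nr_bracket k l x (a *\<^sub>R y + b *\<^sub>R y') = a *\<^sub>R nr_bracket k l x y + b *\<^sub>R nr_bracket k l x y'"
    if "x \<in> nr_space T k" "y \<in> nr_space T l" "y' \<in> nr_space T l" for k l x y y' a b
    using that mem[of y l y' a b]
    by (simp add: nr_bracket_eq_ins ins_add_left[OF nr_spaceD(2)] ins_scale_left[OF nr_spaceD(2)]
        ins_add_right ins_scale_right scaleR_add_right scaleR_diff_right mult.commute)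
  show "nr_bracket k l x y = - (sg (k * l) *\<^sub>R nr_bracket l k y x)"
    if "x \<in> nr_space T k" "y \<in> nr_space T l" for k l x y
    using that by (simp add: nr_bracket_eq_ins scaleR_diff_right mult.commute[of l k])
  show "nr_bracket k (l + m) x (nr_bracket l m y z) =
      nr_bracket (k + l) m (nr_bracket k l x y) z + sg (k * l) *\<^sub>R nr_bracket l (k + m) y (nr_bracket k m x z)"
    if x: "x \<in> nr_space T k" and y: "y \<in> nr_space T l" and z: "z \<in> nr_space T m" for k l m x y z
  proof -
    note sl = nr_spaceD(2)[OF x] nr_spaceD(2)[OF y] nr_spaceD(2)[OF z]
    note expand = ins_diff_left[OF sl(1)] ins_diff_left[OF sl(2)] ins_diff_left[OF sl(3)]
      ins_scale_left[OF sl(1)] ins_scale_left[OF sl(2)] ins_scale_left[OF sl(3)] ins_diff_right ins_scale_right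
    define s t u where "s = sg (k * l)" and "t = sg (k * m)" and "u = sg (l * m)"
    have signs: "sg (k * (l + m)) = s * t" "sg ((k + l) * m) = t * u" "sg (l * (k + m)) = s * u"
      by (simp_all add: s_def t_def u_def distrib_left distrib_right sg_add mult.commute)
    have "ins k x (ins l y z) - ins (k + l) (ins k x y) z = s *\<^sub>R (ins l y (ins k x z) - ins (k + l) (ins l y x) z)"
      unfolding s_def by (rule ins_pre_Lie[OF nr_spaceD(1)[OF x] nr_spaceD(1)[OF y] nr_spaceD(2,3)[OF z]])
    then have 1: "ins k x (ins l y z) = ins (k + l) (ins k x y) z + s *\<^sub>R (ins l y (ins k x z) - ins (k + l) (ins l y x) z)"
      by (simp add: diff_eq_eq add.commute)
    have "ins k x (ins m z y) - ins (k + m) (ins k x z) y = t *\<^sub>R (ins m z (ins k x y) - ins (k + m) (ins m z x) y)"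
      unfolding t_def by (rule ins_pre_Lie[OF nr_spaceD(1)[OF x] nr_spaceD(1)[OF z] nr_spaceD(2,3)[OF y]])
    then have 2: "ins k x (ins m z y) = ins (k + m) (ins k x z) y + t *\<^sub>R (ins m z (ins k x y) - ins (k + m) (ins m z x) y)"
      by (simp add: diff_eq_eq add.commute)
    have "ins l y (ins m z x) - ins (l + m) (ins l y z) x = u *\<^sub>R (ins m z (ins l y x) - ins (l + m) (ins m z y) x)"
      unfolding u_def by (rule ins_pre_Lie[OF nr_spaceD(1)[OF y] nr_spaceD(1)[OF z] nr_spaceD(2,3)[OF x]])
    then have 3: "ins l y (ins m z x) = ins (l + m) (ins l y z) x + u *\<^sub>R (ins m z (ins l y x) - ins (l + m) (ins m z y) x)"
      by (simp add: diff_eq_eq add.commute)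
    have brackets: "nr_bracket l m y z = ins l y z - u *\<^sub>R ins m z y"
      "nr_bracket k l x y = ins k x y - s *\<^sub>R ins l y x"
      "nr_bracket k m x z = ins k x z - t *\<^sub>R ins m z x"
      by (simp_all add: nr_bracket_eq_ins x y z s_def t_def u_def)
    have outer: "nr_bracket k (l + m) x (nr_bracket l m y z) =
        ins k x (nr_bracket l m y z) - (s * t) *\<^sub>R ins (l + m) (nr_bracket l m y z) x"
      "nr_bracket (k + l) m (nr_bracket k l x y) z =
        ins (k + l) (nr_bracket k l x y) z - (t * u) *\<^sub>R ins m z (nr_bracket k l x y)"
      "nr_bracket l (k + m) y (nr_bracket k m x z) =
        ins l y (nr_bracket k m x z) - (s * u) *\<^sub>R ins (k + m) (nr_bracket k m x z) y"
      by (simp_all only: nr_bracket_eq_ins[OF x nr_bracket_closed[OF y z]]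
          nr_bracket_eq_ins[OF nr_bracket_closed[OF x y] z] nr_bracket_eq_ins[OF y nr_bracket_closed[OF x z]] signs)
    have squares: "s * s = 1" "t * t = 1" "u * u = 1"
      by (simp_all add: s_def t_def u_def)
    have squares': "s * (s * c) = c" "t * (t * c) = c" "u * (u * c) = c" for c
      by (simp_all add: squares flip: mult.assoc)
    show ?thesis
      unfolding s_def[symmetric] outer unfolding brackets expand 1 2 3
      by (simp add: scaleR_add_right scaleR_diff_right squares squares' ac_simps)
  qed
qed

end

lemma graded_lie_algebra_restrict:
  assumes G: "graded_lie_algebra G br" and H: "\<And>k. subspace (H k)" "\<And>k. H k \<subseteq> G k"
    and closed: "\<And>x y k l. x \<in> H k \<Longrightarrow> y \<in> H l \<Longrightarrow> br k l x y \<in> H (k + l)"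
  shows "graded_lie_algebra H br"
proof -
  have mem: "x \<in> G k" if "x \<in> H k" for x k
    using H(2) that by (rule subsetD)
  note G = G[unfolded graded_lie_algebra_def]
  show ?thesis
    unfolding graded_lie_algebra_def
  proof (intro conjI allI ballI)
    show "subspace (H k)" for k
      by (rule H(1))
    show "br k l x y \<in> H (k + l)" if "x \<in> H k" "y \<in> H l" for k l x y
      using that by (rule closed)
    show "br k l (a *\<^sub>R x + b *\<^sub>R x') y = a *\<^sub>R br k l x y + b *\<^sub>R br k l x' y"
      if "x \<in> H k" "x' \<in> H k" "y \<in> H l" for k l x x' y a b
      using conjunct1[OF conjunct2[OF conjunct2[OF G]]] mem[OF that(1)] mem[OF that(2)] mem[OF that(3)] by simp
    show "br k l x (a *\<^sub>R y + b *\<^sub>R y') = a *\<^sub>R br k l x y + b *\<^sub>R br k l x y'"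
      if "x \<in> H k" "y \<in> H l" "y' \<in> H l" for k l x y y' a b
      using conjunct1[OF conjunct2[OF conjunct2[OF conjunct2[OF G]]]] mem[OF that(1)] mem[OF that(2)] mem[OF that(3)]
      by simp
    show "br k l x y = - (((- 1) powi (k * l)) *\<^sub>R br l k y x)"
      if "x \<in> H k" "y \<in> H l" for k l x y
      using G mem[OF that(1)] mem[OF that(2)] by blast
    show "br k (l + m) x (br l m y z) =
        br (k + l) m (br k l x y) z + ((- 1) powi (k * l)) *\<^sub>R br l (k + m) y (br k m x z)"
      if "x \<in> H k" "y \<in> H l" "z \<in> H m" for k l m x y z
      using G mem[OF that(1)] mem[OF that(2)] mem[OF that(3)] by blast
  qed
qed

section \<open>The Schouten-Nijenhuis algebra\<close>

context convenient_algebra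
begin

sublocale convenient_base T
  by unfold_locales (rule topspace, rule convenient)

abbreviation "PD \<equiv> polyderivations T mul"

text \<open>
  By skew symmetry the product rule in the first slot implies it in every slot. Degree \<open>- 1\<close> is
  separate: a constant satisfies the product rule vacuously, but the component is \<open>0\<close>.
\<close>

lemma polyderivations_iff:
  "x \<in> PD k \<longleftrightarrow> x \<in> nr_space T k \<and> (if k < 0 then x = 0 else leibniz mul x)"
proof (cases "k < 0")
  case True
  then show ?thesis
    using subspace_0[OF subspace_nr_space] by (auto simp: polyderivations_def)
next
  case False
  have "leibniz mul x \<longleftrightarrow> (\<forall>as. length as = nat k \<longrightarrow> derivation mul (\<lambda>a. x (a # as)))"
    if x: "x \<in> nr_space T k"
  proof
    assume "leibniz mul x"
    then show "\<forall>as. length as = nat k \<longrightarrow> derivation mul (\<lambda>a. x (a # as))"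
      using slotwise_linear_first[OF nr_spaceD(2)[OF x]] leibnizD[of mul x "[]"]
      by (simp add: derivation_def)
  next
    assume der: "\<forall>as. length as = nat k \<longrightarrow> derivation mul (\<lambda>a. x (a # as))"
    show "leibniz mul x"
    proof (rule leibnizI[OF bilinear_mul nr_spaceD(3)[OF x]])
      fix a b as
      show "x (mul a b # as) = mul (x (a # as)) b + mul a (x (b # as))"
      proof (cases "length as = nat k")
        case True
        then show ?thesis
          using der by (simp add: derivation_def)
      next
        case False
        then have "x (c # as) = 0" for c
          using nr_spaceD(1)[OF x] by (auto simp: homogeneous_def)
        then show ?thesis
          by (simp add: bilinear_lzero[OF bilinear_mul] bilinear_rzero[OF bilinear_mul])
      qed
    qed
  qed
  then show ?thesis
    using False by (auto simp: polyderivations_def nr_space_def)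
qed

lemma polyderivations_subset: "PD k \<subseteq> nr_space T k"
  using polyderivations_iff by blast

lemma subspace_polyderivations: "subspace (PD k)"
proof (cases "k < 0")
  case True
  then show ?thesis
    by (simp add: polyderivations_def subspace_single_0)
next
  case False
  show ?thesis
  proof (rule subspaceI)
    show "0 \<in> PD k"
      using False subspace_0[OF subspace_nr_space] bilinear_lzero[OF bilinear_mul] bilinear_rzero[OF bilinear_mul]
      by (simp add: polyderivations_iff leibniz_def)
    show "x + y \<in> PD k" if "x \<in> PD k" "y \<in> PD k" for x y
      using that False subspace_add[OF subspace_nr_space]
      by (simp add: polyderivations_iff leibniz_def bilinear_ladd[OF bilinear_mul] bilinear_radd[OF bilinear_mul])
    show "c *\<^sub>R x \<in> PD k" if "x \<in> PD k" for c x
      using that False subspace_scale[OF subspace_nr_space]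
      by (simp add: polyderivations_iff leibniz_def scaleR_fun_apply scaleR_add_right
          bilinear_lmul[OF bilinear_mul] bilinear_rmul[OF bilinear_mul])
  qed
qed

lemma nr_bracket_polyderivations:
  assumes x: "x \<in> PD k" and y: "y \<in> PD l"
  shows "nr_bracket k l x y \<in> PD (k + l)"
proof -
  have nx: "x \<in> nr_space T k" and ny: "y \<in> nr_space T l"
    using x y polyderivations_subset by blast+
  have closed: "nr_bracket k l x y \<in> nr_space T (k + l)"
    using nx ny by (rule nr_bracket_closed)
  show ?thesis
  proof (cases "k < 0 \<or> l < 0")
    case True
    then have "x = 0 \<or> y = 0"
      using x y by (auto simp: polyderivations_def)
    then have "nr_bracket k l x y = 0"
      using ins_zero_left[OF nr_spaceD(2)[OF nx]] ins_zero_left[OF nr_spaceD(2)[OF ny]]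
      by (auto simp: nr_bracket_eq_ins[OF nx ny])
    then show ?thesis
      by (simp add: subspace_0[OF subspace_polyderivations])
  next
    case False
    then have lx: "leibniz mul x" and ly: "leibniz mul y"
      using x y by (simp_all add: polyderivations_iff)
    have "leibniz mul (nr_bracket k l x y)"
    proof (rule leibnizI[OF bilinear_mul nr_spaceD(3)[OF closed]])
      show "nr_bracket k l x y (mul a b # ws) =
        mul (nr_bracket k l x y (a # ws)) b + mul a (nr_bracket k l x y (b # ws))" for a b ws
        by (rule bracket_leibniz[OF bilinear_mul nr_spaceD[OF nx] lx nr_spaceD[OF ny] ly nr_bracket_eq_ins[OF nx ny]])
    qed
    then show ?thesis
      using closed False by (simp add: polyderivations_iff)
  qed
qed

text \<open>
  Multiplication by a fixed element is bounded and linear, hence sequentially continuous. So the product rule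
  passes to pointwise limits.
\<close>

lemma limit_mul:
  assumes "limitin T x l sequentially"
  shows "limitin T (\<lambda>n. mul (x n) b) (mul l b) sequentially"
    and "limitin T (\<lambda>n. mul b (x n)) (mul b l) sequentially"
proof -
  have left: "vn_bounded T ((\<lambda>x. mul x b) ` B)" if B: "vn_bounded T B" for B
  proof -
    have "vn_bounded T {mul x y | x y. x \<in> B \<and> y \<in> {b}}"
      using bounded_mul B bounded_singleton[of b] unfolding bounded_binary_def by blast
    then show ?thesis
      by (rule bounded_subset) blast
  qed
  have right: "vn_bounded T ((\<lambda>x. mul b x) ` B)" if B: "vn_bounded T B" for B
  proof -
    have "vn_bounded T {mul x y | x y. x \<in> {b} \<and> y \<in> B}"
      using bounded_mul B bounded_singleton[of b] unfolding bounded_binary_def by blast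
    then show ?thesis
      by (rule bounded_subset) blast
  qed
  show "limitin T (\<lambda>n. mul (x n) b) (mul l b) sequentially"
    by (rule limit_linear[OF linear_of_bilinear(1)[OF bilinear_mul] left assms])
  show "limitin T (\<lambda>n. mul b (x n)) (mul b l) sequentially"
    by (rule limit_linear[OF linear_of_bilinear(2)[OF bilinear_mul] right assms])
qed

lemma polyderivations_function_space: "function_space T (nat (k + 1)) (PD k)"
proof (unfold_locales)
  show "subspace (PD k)"
    by (rule subspace_polyderivations)
  show "PD k \<subseteq> skew_maps T (nat (k + 1))"
    using polyderivations_subset nr_space_subset by (rule subset_trans)
  fix h f
  assume h: "\<And>m. h m \<in> PD k" and f: "f \<in> skew_maps T (nat (k + 1))"
    and lim: "\<And>xs. limitin T (\<lambda>m. h m xs) (f xs) sequentially"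
  show "f \<in> PD k"
  proof (cases "k < 0")
    case True
    then have "h m = 0" for m
      using h by (simp add: polyderivations_def)
    then have "f xs = 0" for xs
      using limit_unique[OF lim[of xs], of 0] limit_const[of 0] by simp
    then have "f = 0"
      by (simp add: fun_eq_iff)
    then show ?thesis
      by (simp add: subspace_0[OF subspace_polyderivations])
  next
    case False
    have "leibniz mul f"
      unfolding leibniz_def
    proof (intro allI)
      fix us ws a b
      have "h m (us @ mul a b # ws) = mul (h m (us @ a # ws)) b + mul a (h m (us @ b # ws))" for m
        using h[of m] False by (intro leibnizD) (simp add: polyderivations_iff)
      then have "limitin T (\<lambda>m. mul (h m (us @ a # ws)) b + mul a (h m (us @ b # ws))) (f (us @ mul a b # ws)) sequentially"
        using lim[of "us @ mul a b # ws"] by simp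
      moreover have "limitin T (\<lambda>m. mul (h m (us @ a # ws)) b + mul a (h m (us @ b # ws)))
          (mul (f (us @ a # ws)) b + mul a (f (us @ b # ws))) sequentially"
        by (rule limit_add[OF limit_mul(1)[OF lim] limit_mul(2)[OF lim]])
      ultimately show "f (us @ mul a b # ws) = mul (f (us @ a # ws)) b + mul a (f (us @ b # ws))"
        by (rule limit_unique)
    qed
    then show ?thesis
      using False f by (simp add: polyderivations_iff nr_space_def)
  qed
qed

text \<open>
  In the topology on all bounded skew symmetric maps the bounded sets are the uniformly bounded ones,
  and so they are in its trace on the polyderivations. The bornologification depends on nothing else.
\<close>

lemma polyderivations_topology:
  shows topspace_polyderivations: "topspace (polyderivations_topology T mul k) = PD k"
    and convenient_polyderivations: "convenient_space (polyderivations_topology T mul k)"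
    and bounded_polyderivations: "vn_bounded (polyderivations_topology T mul k) S \<longleftrightarrow>
      S \<subseteq> PD k \<and> uniformly_bounded T (nat (k + 1)) S"
proof -
  let ?n = "nat (k + 1)"
  interpret P: function_space T ?n "PD k"
    by (rule polyderivations_function_space)
  interpret S: function_space T ?n "skew_maps T ?n"
    by unfold_locales (auto simp: subspace_skew_maps)
  have skew: "skew_maps_topology T ?n = bornological_topology (skew_maps T ?n) S.uniform_bornology"
    by (simp add: skew_maps_topology_def S.uniform_bornology_def)
  have sub: "PD k \<subseteq> topspace (skew_maps_topology T ?n)"
    unfolding skew S.F.topspace by (rule P.V_skew)
  have "polyderivations_topology T mul k = bornological_topology (PD k) P.uniform_bornology"
    unfolding polyderivations_topology_def
  proof (rule P.bornologification_eq)
    show "topspace (subtopology (skew_maps_topology T ?n) (PD k)) = PD k"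
      using sub by (simp add: inf.absorb2)
    show "vn_bounded (subtopology (skew_maps_topology T ?n) (PD k)) S \<longleftrightarrow>
        S \<subseteq> PD k \<and> uniformly_bounded T ?n S" for S
      unfolding vn_bounded_subtopology[OF subspace_polyderivations sub]
      unfolding skew S.vn_bounded_iff_uniformly_bounded using P.V_skew by blast
  qed
  then show "topspace (polyderivations_topology T mul k) = PD k"
    and "convenient_space (polyderivations_topology T mul k)"
    and "vn_bounded (polyderivations_topology T mul k) S \<longleftrightarrow> S \<subseteq> PD k \<and> uniformly_bounded T ?n S"
    using P.F.topspace P.convenient_function_space P.vn_bounded_iff_uniformly_bounded by simp_all
qed

lemma bounded_bracket:
  "bounded_binary (polyderivations_topology T mul k) (polyderivations_topology T mul l)
     (polyderivations_topology T mul (k + l)) (nr_bracket k l)"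
  unfolding bounded_binary_def bounded_polyderivations
proof (intro allI impI, elim conjE, intro conjI)
  fix S S' assume S: "S \<subseteq> PD k" "uniformly_bounded T (nat (k + 1)) S"
    and S': "S' \<subseteq> PD l" "uniformly_bounded T (nat (l + 1)) S'"
  show "{nr_bracket k l x y | x y. x \<in> S \<and> y \<in> S'} \<subseteq> PD (k + l)"
    using S(1) S'(1) nr_bracket_polyderivations by blast
  have nr: "S \<subseteq> nr_space T k" "S' \<subseteq> nr_space T l"
    using S(1) S'(1) polyderivations_subset by blast+
  have "bounded_family S" "bounded_family S'"
    using nr nr_space_subset S(2) S'(2) by (blast intro: bounded_family_of_uniformly_bounded)+
  then show "uniformly_bounded T (nat (k + l + 1)) {nr_bracket k l x y | x y. x \<in> S \<and> y \<in> S'}"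
    using nr by (intro uniformly_bounded_of_family bounded_family_nr_bracket)
qed

lemma schouten_nijenhuis_algebra: "graded_lie_algebra PD nr_bracket"
  by (rule graded_lie_algebra_restrict[OF nijenhuis_richardson_algebra subspace_polyderivations polyderivations_subset
        nr_bracket_polyderivations])

end

theorem theorem7p4:
  fixes T :: "'a::real_vector topology"
    and mul :: "'a \<Rightarrow> 'a \<Rightarrow> 'a"
    and one :: 'a
  assumes "convenient_algebra T mul one"
  shows "graded_lie_subalgebra (polyderivations T mul) (nr_space T) nr_bracket \<and>
         convenient_graded_lie_algebra (polyderivations T mul) (polyderivations_topology T mul)
           nr_bracket"
proof -
  interpret convenient_algebra T mul one
    by (rule assms)
  show ?thesis
    unfolding graded_lie_subalgebra_def convenient_graded_lie_algebra_def
    by (intro conjI allI ballI nijenhuis_richardson_algebra subspace_polyderivations polyderivations_subset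
        nr_bracket_polyderivations schouten_nijenhuis_algebra topspace_polyderivations
        convenient_polyderivations bounded_bracket)
qed

end
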